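(* Let $k$ be a field of characteristic $p>0$ with $[k:k^p]<\infty$, let $R=k[x_0,\dots,x_n]$ with its standard grading, $\mathfrak m=(x_0,\dots,x_n)$, and let $f\in R$ be a homogeneous polynomial of degree $d$. Suppose that $\tau(f^{1-\frac1p})=\mathfrak m^j$ for some integer $j\ge 1$. Then the Frobenius action $$F: H^n_{\mathfrak m}(R/fR)_{<-n-j+d}\to H^n_{\mathfrak m}(R/fR)_{<p(-n-j+d)}$$ is injective.
   Context: For an ideal $I\subseteq R$ and $e\ge 0$, $I^{[p^e]}=(u^{p^e}\mid u\in I)$. The test ideal $\tau(f^{1-\frac1{p}})$ is the smallest ideal $\mathfrak a\subseteq R$ such that $f^{p-1}\in\mathfrak a^{[p]}$. The local cohomology module $H^n_{\mathfrak m}(R/fR)$ is $\mathbb Z$-graded. The Frobenius action $F$ on it is the additive map induced by the Frobenius ring homomorphism $R/fR\to R/fR$, $a\mapsto a^p$; it sends degree $i$ to degree $pi$. For a graded module $H$, $H_{<N}$ denotes the direct sum of its graded pieces of degree less than $N$. *)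

theory Defs
  imports
    "HOL-Algebra.Algebra"
    "HOL-Algebra.Algebraic_Closure_Type"
    "HOL-Library.Poly_Mapping"
begin

section \<open>The polynomial ring\<close>

text \<open>
  Polynomials with coefficients in \<open>'k\<close> and variables \<open>'v\<close> are the finitely supported functions
  from exponent vectors to coefficients, with the convolution product of \<^type>\<open>poly_mapping\<close>.
\<close>

type_synonym ('v, 'k) mpoly = "('v \<Rightarrow>\<^sub>0 nat) \<Rightarrow>\<^sub>0 'k"

abbreviation mpoly_ring :: "('v::finite, 'k::field) mpoly ring"
  where "mpoly_ring \<equiv> ring_of_type_algebra"

definition mpoly_var :: "'v::finite \<Rightarrow> ('v, 'k::field) mpoly"
  where "mpoly_var i = Poly_Mapping.single (Poly_Mapping.single i 1) 1"

definition irrelevant_ideal :: "('v::finite, 'k::field) mpoly set"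
  where "irrelevant_ideal = Idl\<^bsub>mpoly_ring\<^esub> (range mpoly_var)"

text \<open>
  As the grading is by integers, the pieces of negative degree are \<open>{0}\<close>.
\<close>

definition homogeneous_polys :: "int \<Rightarrow> ('v::finite, 'k::field) mpoly set"
  where "homogeneous_polys i =
    {g. \<forall>m \<in> Poly_Mapping.keys g. int (\<Sum>v\<in>UNIV. Poly_Mapping.lookup m v) = i}"


section \<open>Frobenius powers and the test ideal\<close>

definition frobenius_power :: "('a, 'b) ring_scheme \<Rightarrow> nat \<Rightarrow> nat \<Rightarrow> 'a set \<Rightarrow> 'a set"
  where "frobenius_power R p e I = Idl\<^bsub>R\<^esub> ((\<lambda>u. u [^]\<^bsub>R\<^esub> (p ^ e)) ` I)"

text \<open>
  \<open>test_ideal R p f\<close> is \<open>\<tau>(f\<^sup>1\<^sup>-\<^sup>1\<^sup>/\<^sup>p)\<close>; the order on sets is inclusion, so \<open>LEAST\<close> is the smallest ideal.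
\<close>

definition test_ideal :: "('a, 'b) ring_scheme \<Rightarrow> nat \<Rightarrow> 'a \<Rightarrow> 'a set"
  where "test_ideal R p f =
    (LEAST I. ideal I R \<and> f [^]\<^bsub>R\<^esub> (p - 1) \<in> frobenius_power R p 1 I)"


section \<open>Localization of a commutative ring\<close>

text \<open>
  The fraction \<open>a / s\<close>, as an equivalence class of pairs, for a multiplicatively closed set \<open>S\<close>
  containing 1. The ring \<open>A\<close> may have zero divisors.
\<close>

definition fraction :: "('a, 'b) ring_scheme \<Rightarrow> 'a set \<Rightarrow> 'a \<Rightarrow> 'a \<Rightarrow> ('a \<times> 'a) set"
  where "fraction A S a s =
    {(b, t). b \<in> carrier A \<and> t \<in> S \<and>
      (\<exists>u\<in>S. u \<otimes>\<^bsub>A\<^esub> (a \<otimes>\<^bsub>A\<^esub> t \<ominus>\<^bsub>A\<^esub> b \<otimes>\<^bsub>A\<^esub> s) = \<zero>\<^bsub>A\<^esub>)}"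

definition localization :: "('a, 'b) ring_scheme \<Rightarrow> 'a set \<Rightarrow> ('a \<times> 'a) set ring"
  where "localization A S =
    \<lparr>carrier = {fraction A S a s |a s. a \<in> carrier A \<and> s \<in> S},
     monoid.mult = (\<lambda>U V. \<Union>(a, s)\<in>U. \<Union>(b, t)\<in>V. fraction A S (a \<otimes>\<^bsub>A\<^esub> b) (s \<otimes>\<^bsub>A\<^esub> t)),
     one = fraction A S \<one>\<^bsub>A\<^esub> \<one>\<^bsub>A\<^esub>,
     ring.zero = fraction A S \<zero>\<^bsub>A\<^esub> \<one>\<^bsub>A\<^esub>,
     add = (\<lambda>U V. \<Union>(a, s)\<in>U. \<Union>(b, t)\<in>V.
       fraction A S (a \<otimes>\<^bsub>A\<^esub> t \<oplus>\<^bsub>A\<^esub> b \<otimes>\<^bsub>A\<^esub> s) (s \<otimes>\<^bsub>A\<^esub> t))\<rparr>"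

text \<open>
  The map \<open>a / s \<mapsto> \<phi> a / \<phi> s\<close> from \<open>S\<^sup>-\<^sup>1A\<close> to \<open>T\<^sup>-\<^sup>1A\<close> induced by a ring endomorphism \<open>\<phi>\<close> of \<open>A\<close>
  with \<open>\<phi> S \<subseteq> T\<close>.
\<close>

definition localization_map ::
    "('a, 'b) ring_scheme \<Rightarrow> 'a set \<Rightarrow> ('a \<Rightarrow> 'a) \<Rightarrow> ('a \<times> 'a) set \<Rightarrow> ('a \<times> 'a) set"
  where "localization_map A T \<phi> U = (\<Union>(a, s)\<in>U. fraction A T (\<phi> a) (\<phi> s))"

text \<open>
  For a graded ring \<open>A\<close> with graded pieces \<open>Gr i\<close> and a set \<open>S\<close> of homogeneous elements, the
  piece of degree \<open>i\<close> of \<open>S\<^sup>-\<^sup>1A\<close> consists of the fractions \<open>a / s\<close> with \<open>deg a - deg s = i\<close>.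
\<close>

definition localization_piece ::
    "('a, 'b) ring_scheme \<Rightarrow> 'a set \<Rightarrow> (int \<Rightarrow> 'a set) \<Rightarrow> int \<Rightarrow> ('a \<times> 'a) set set"
  where "localization_piece A S Gr i =
    {fraction A S a s |a s e. s \<in> S \<and> s \<in> Gr e \<and> a \<in> Gr (i + e)}"


section \<open>Local cohomology via the Cech complex\<close>

text \<open>
  Local cohomology of a noetherian ring \<open>A\<close> with support in the ideal generated by a finite
  family \<open>x\<close> is the cohomology of the Cech complex of \<open>x\<close>, whose term in degree \<open>q\<close> is the product
  of the localizations of \<open>A\<close> at \<open>\<Prod>i\<in>J. x i\<close> over the \<open>q\<close>-element sets \<open>J\<close> of indices. That localization is
  formed here with the denominators \<open>\<Prod>i\<in>J. (x i) ^ (e i)\<close>, so that these sets of denominators increase with \<open>J\<close>.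
  The groups below are written multiplicatively, as in \<^const>\<open>product_group\<close> and \<^const>\<open>FactGroup\<close>,
  but are the additive groups.
\<close>

definition denominators :: "('a, 'b) ring_scheme \<Rightarrow> ('v \<Rightarrow> 'a) \<Rightarrow> 'v set \<Rightarrow> 'a set"
  where "denominators A x J =
    range (\<lambda>e :: 'v \<Rightarrow> nat. \<Otimes>\<^bsub>A\<^esub>i\<in>J. x i [^]\<^bsub>A\<^esub> e i)"

abbreviation cech_localization ::
    "('a, 'b) ring_scheme \<Rightarrow> ('v \<Rightarrow> 'a) \<Rightarrow> 'v set \<Rightarrow> ('a \<times> 'a) set ring"
  where "cech_localization A x J \<equiv> localization A (denominators A x J)"

definition cech_cochains ::
    "('a, 'b) ring_scheme \<Rightarrow> ('v::finite \<Rightarrow> 'a) \<Rightarrow> nat \<Rightarrow> ('v set \<Rightarrow> ('a \<times> 'a) set) monoid"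
  where "cech_cochains A x q =
    product_group {J. card J = q} (\<lambda>J. add_monoid (cech_localization A x J))"

definition cech_differential ::
    "('a, 'b) ring_scheme \<Rightarrow> ('v::{finite,linorder} \<Rightarrow> 'a) \<Rightarrow> nat \<Rightarrow>
      ('v set \<Rightarrow> ('a \<times> 'a) set) \<Rightarrow> 'v set \<Rightarrow> ('a \<times> 'a) set"
  where "cech_differential A x q z =
    (\<lambda>K\<in>{K. card K = q + 1}. \<Oplus>\<^bsub>cech_localization A x K\<^esub>i\<in>K.
      (let y = localization_map A (denominators A x K) (\<lambda>a. a) (z (K - {i}))
       in if even (card {l\<in>K. l < i}) then y else \<ominus>\<^bsub>cech_localization A x K\<^esub> y))"

definition cech_cocycles ::
    "('a, 'b) ring_scheme \<Rightarrow> ('v::{finite,linorder} \<Rightarrow> 'a) \<Rightarrow> nat \<Rightarrow> ('v set \<Rightarrow> ('a \<times> 'a) set) set"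
  where "cech_cocycles A x q =
    kernel (cech_cochains A x q) (cech_cochains A x (q + 1)) (cech_differential A x q)"

definition cech_coboundaries ::
    "('a, 'b) ring_scheme \<Rightarrow> ('v::{finite,linorder} \<Rightarrow> 'a) \<Rightarrow> nat \<Rightarrow> ('v set \<Rightarrow> ('a \<times> 'a) set) set"
  where "cech_coboundaries A x q =
    (if q = 0 then {\<one>\<^bsub>cech_cochains A x q\<^esub>}
     else cech_differential A x (q - 1) ` carrier (cech_cochains A x (q - 1)))"

definition local_cohomology ::
    "('a, 'b) ring_scheme \<Rightarrow> ('v::{finite,linorder} \<Rightarrow> 'a) \<Rightarrow> nat \<Rightarrow>
      ('v set \<Rightarrow> ('a \<times> 'a) set) set monoid"
  where "local_cohomology A x q =
    (cech_cochains A x q)\<lparr>carrier := cech_cocycles A x q\<rparr> Mod cech_coboundaries A x q"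

text \<open>
  The classes of cocycles all of whose components are homogeneous of degree \<open>i\<close>, and the direct sum
  of these pieces over all \<open>i < N\<close>.
\<close>

definition local_cohomology_piece ::
    "('a, 'b) ring_scheme \<Rightarrow> (int \<Rightarrow> 'a set) \<Rightarrow> ('v::{finite,linorder} \<Rightarrow> 'a) \<Rightarrow> nat \<Rightarrow> int \<Rightarrow>
      ('v set \<Rightarrow> ('a \<times> 'a) set) set set"
  where "local_cohomology_piece A Gr x q i =
    {cech_coboundaries A x q #>\<^bsub>cech_cochains A x q\<^esub> z |z. z \<in> cech_cocycles A x q \<and>
      (\<forall>J. card J = q \<longrightarrow> z J \<in> localization_piece A (denominators A x J) Gr i)}"

definition local_cohomology_below ::
    "('a, 'b) ring_scheme \<Rightarrow> (int \<Rightarrow> 'a set) \<Rightarrow> ('v::{finite,linorder} \<Rightarrow> 'a) \<Rightarrow> nat \<Rightarrow> int \<Rightarrow>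
      ('v set \<Rightarrow> ('a \<times> 'a) set) set monoid"
  where "local_cohomology_below A Gr x q N =
    (local_cohomology A x q)
      \<lparr>carrier := generate (local_cohomology A x q) (\<Union>i\<in>{..<N}. local_cohomology_piece A Gr x q i)\<rparr>"

text \<open>
  The map on cohomology induced, through the Cech complex, by the Frobenius \<open>a \<mapsto> a ^ p\<close> of \<open>A\<close>.
\<close>

definition cech_frobenius ::
    "('a, 'b) ring_scheme \<Rightarrow> ('v::finite \<Rightarrow> 'a) \<Rightarrow> nat \<Rightarrow> nat \<Rightarrow>
      ('v set \<Rightarrow> ('a \<times> 'a) set) \<Rightarrow> 'v set \<Rightarrow> ('a \<times> 'a) set"
  where "cech_frobenius A x p q z =
    (\<lambda>J\<in>{J. card J = q}. localization_map A (denominators A x J) (\<lambda>a. a [^]\<^bsub>A\<^esub> p) (z J))"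

definition frobenius_action ::
    "('a, 'b) ring_scheme \<Rightarrow> ('v::{finite,linorder} \<Rightarrow> 'a) \<Rightarrow> nat \<Rightarrow> nat \<Rightarrow>
      ('v set \<Rightarrow> ('a \<times> 'a) set) set \<Rightarrow> ('v set \<Rightarrow> ('a \<times> 'a) set) set"
  where "frobenius_action A x p q U =
    (\<Union>z\<in>U. cech_coboundaries A x q #>\<^bsub>cech_cochains A x q\<^esub> cech_frobenius A x p q z)"


section \<open>The graded ring \<open>R/fR\<close>\<close>

definition hypersurface_ring :: "('v::finite, 'k::field) mpoly \<Rightarrow> ('v, 'k) mpoly set ring"
  where "hypersurface_ring f = mpoly_ring Quot (PIdl\<^bsub>mpoly_ring\<^esub> f)"

definition residue :: "('v::finite, 'k::field) mpoly \<Rightarrow> ('v, 'k) mpoly \<Rightarrow> ('v, 'k) mpoly set"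
  where "residue f g = PIdl\<^bsub>mpoly_ring\<^esub> f +>\<^bsub>mpoly_ring\<^esub> g"

definition residue_grading ::
    "('v::finite, 'k::field) mpoly \<Rightarrow> int \<Rightarrow> ('v, 'k) mpoly set set"
  where "residue_grading f i = residue f ` homogeneous_polys i"

end

theory Submission
  imports Defs
begin

text \<open>
  Write \<open>R = k[x\<^sub>0, \<dots>, x\<^sub>n]\<close> and \<open>A = R/fR\<close>. The sequence \<open>0 \<rightarrow> R(-d) \<rightarrow> R \<rightarrow> A \<rightarrow> 0\<close> given by
  multiplication with \<open>f\<close>, together with \<open>H\<^sup>n(R) = 0\<close>, identifies \<open>H\<^sup>n(A)\<close> with the elements of
  \<open>H\<^sup>n\<^sup>+\<^sup>1(R)\<close> killed by \<open>f\<close>, up to a shift of the degree by \<open>d\<close>. The Frobenius action of \<open>A\<close> becomes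
  \<open>\<eta> \<mapsto> f\<^sup>p\<^sup>-\<^sup>1 F(\<eta>)\<close>. As \<open>R\<close> is free over \<open>R\<^sup>p\<close>, the equation \<open>f\<^sup>p\<^sup>-\<^sup>1 F(\<eta>) = 0\<close> says exactly that \<open>\<eta>\<close>
  is killed by every coefficient of \<open>f\<^sup>p\<^sup>-\<^sup>1\<close> with respect to a basis (after extraction of a \<open>p\<close>-th
  root), and these coefficients generate the test ideal. So \<open>\<eta>\<close> is killed by \<open>\<mm>\<^sup>j\<close>. But \<open>H\<^sup>n\<^sup>+\<^sup>1(R)\<close> has the
  monomials with all exponents negative as a basis, and such a monomial of degree less than \<open>-n-j\<close>
  survives multiplication by a suitable monomial of degree \<open>j\<close>. Hence \<open>\<eta> = 0\<close> if the degrees in \<open>\<eta>\<close> are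
  less than \<open>-n-j\<close>, which is degree less than \<open>-n-j+d\<close> on the side of \<open>A\<close>.

  All computations take place in one integral domain, the Laurent polynomials in \<open>x\<^sub>0, \<dots>, x\<^sub>n\<close>. The
  localization of \<open>R\<close> at the variables with index in \<open>J\<close> is the subring \<open>loc J\<close>, and the elements of the
  corresponding localization of \<open>A\<close> are the classes \<open>lclass f J g\<close> of \<open>g \<in> loc J\<close> modulo \<open>f\<close>
  (\<open>fraction_eq_lclass\<close>, \<open>lclass_eq_iff\<close>). A cocycle of \<open>A\<close> in degree \<open>n\<close> is therefore represented by Laurent
  polynomials whose alternating sum is a multiple \<open>f g\<close>, and \<open>g\<close>, taken modulo the submodule
  \<open>cech_image\<close> of Laurent polynomials without totally negative exponents, is the connecting map: the
  class of the cocycle vanishes iff \<open>g \<in> cech_image\<close> (\<open>coboundary_imp_cech_image\<close> and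
  \<open>cech_image_imp_coboundary\<close>, the latter from \<open>cech_exact\<close>). Frobenius turns \<open>g\<close> into \<open>f\<^sup>p\<^sup>-\<^sup>1 g\<^sup>p\<close>, and the
  argument above is \<open>frobenius_twist_injective\<close>; it rests on \<open>test_ideal_eq\<close>.
\<close>

section \<open>Finitely supported functions\<close>

abbreviation "lookup \<equiv> Poly_Mapping.lookup"
abbreviation "keys \<equiv> Poly_Mapping.keys"
abbreviation "single \<equiv> Poly_Mapping.single"

type_synonym ('v, 'k) laurent = "('v \<Rightarrow>\<^sub>0 int) \<Rightarrow>\<^sub>0 'k"

lemma sum_monomials: "(\<Sum>m\<in>keys g. single m (lookup g m)) = g"
  by (rule poly_mapping_eqI)
     (auto simp: lookup_sum lookup_single when_def in_keys_iff sum.delta)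

lemma lookup_single_times:
  fixes g :: "'a::ab_group_add \<Rightarrow>\<^sub>0 'b::semiring_0"
  shows "lookup (single a c * g) b = c * lookup g (b - a)"
proof -
  have "single a c * g = (\<Sum>m\<in>keys g. single (a + m) (c * lookup g m))"
    by (subst (1) sum_monomials[of g, symmetric]) (simp only: sum_distrib_left mult_single)
  also have "lookup \<dots> b = (\<Sum>m\<in>keys g. if m = b - a then c * lookup g m else 0)"
    unfolding lookup_sum lookup_single when_def by (rule sum.cong) (auto simp: algebra_simps)
  also have "\<dots> = c * lookup g (b - a)"
    by (simp add: sum.delta in_keys_iff)
  finally show ?thesis .
qed

lemma keys_single_times:
  fixes g :: "'a::ab_group_add \<Rightarrow>\<^sub>0 'b::semiring_1"
  shows "keys (single a 1 * g) = (+) a ` keys g"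
proof -
  have "b \<in> (+) a ` keys g" if "b \<in> keys (single a 1 * g)" for b
    using that by (intro image_eqI[of _ _ "b - a"]) (auto simp: in_keys_iff lookup_single_times)
  then show ?thesis by (auto simp: in_keys_iff lookup_single_times)
qed

text \<open>
  This makes the additivity of \<open>g \<mapsto> g ^ p\<close> available for polynomials and Laurent polynomials.
\<close>

lemma CHAR_poly_mapping [simp]:
  "CHAR('a::comm_monoid_add \<Rightarrow>\<^sub>0 'b::comm_semiring_1) = CHAR('b)"
proof (rule CHAR_eqI)
  show "of_nat CHAR('b) = (0 :: 'a \<Rightarrow>\<^sub>0 'b)"
    by (metis of_nat_CHAR single_of_nat single_zero)
  show "CHAR('b) dvd n" if "of_nat n = (0 :: 'a \<Rightarrow>\<^sub>0 'b)" for n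
    using arg_cong[OF that, of "\<lambda>g. lookup g 0"]
    by (simp add: lookup_of_nat of_nat_eq_0_iff_char_dvd)
qed

definition project :: "('a \<Rightarrow> bool) \<Rightarrow> ('a \<Rightarrow>\<^sub>0 'b::zero) \<Rightarrow> 'a \<Rightarrow>\<^sub>0 'b"
  where "project P = Poly_Mapping.mapp (\<lambda>a c. c when P a)"

lemma lookup_project: "lookup (project P g) a = (lookup g a when P a)"
  by (auto simp: project_def lookup_mapp when_def in_keys_iff)

lemma keys_project: "keys (project P g) = {a \<in> keys g. P a}"
  by (auto simp: in_keys_iff lookup_project)

lemma project_add_complement:
  fixes g :: "'a \<Rightarrow>\<^sub>0 'b::monoid_add"
  shows "project P g + project (\<lambda>a. \<not> P a) g = g"
  by (rule poly_mapping_eqI) (auto simp: lookup_add lookup_project when_def)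

lemma project_add: "project P (g + h) = project P g + project P h"
  by (rule poly_mapping_eqI) (auto simp: lookup_add lookup_project when_def)

lemma project_zero [simp]: "project P 0 = 0"
  by (rule poly_mapping_eqI) (auto simp: lookup_project when_def)

lemma project_minus: "project P (g - h) = project P g - project P (h :: _ \<Rightarrow>\<^sub>0 _::ab_group_add)"
  by (rule poly_mapping_eqI) (auto simp: lookup_minus lookup_project when_def)

lemma project_sum: "project P (sum g I) = (\<Sum>i\<in>I. project P (g i))"
  by (induction I rule: infinite_finite_induct) (auto simp: project_add)

section \<open>Laurent polynomials\<close>

definition int_exp :: "('v \<Rightarrow>\<^sub>0 nat) \<Rightarrow> ('v \<Rightarrow>\<^sub>0 int)"
  where "int_exp = Poly_Mapping.map int"

lemma lookup_int_exp [simp]: "lookup (int_exp m) v = int (lookup m v)"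
  by (simp add: int_exp_def Poly_Mapping.map.rep_eq when_def)

lemma int_exp_add: "int_exp (m + m') = int_exp m + int_exp m'"
  by (rule poly_mapping_eqI) (simp add: lookup_add)

lemma int_exp_zero [simp]: "int_exp 0 = 0"
  by (rule poly_mapping_eqI) simp

lemma int_exp_eq_iff [simp]: "int_exp m = int_exp m' \<longleftrightarrow> m = m'"
  by (auto simp: poly_mapping_eq_iff fun_eq_iff)

lemma range_int_exp: "a \<in> range int_exp \<longleftrightarrow> (\<forall>v. 0 \<le> lookup a v)"
proof
  assume "\<forall>v. 0 \<le> lookup a v"
  then have "a = int_exp (Poly_Mapping.map nat a)"
    by (intro poly_mapping_eqI) (simp add: Poly_Mapping.map.rep_eq when_def)
  then show "a \<in> range int_exp" by blast
qed auto

definition laurent :: "('v, 'k::comm_ring_1) mpoly \<Rightarrow> ('v, 'k) laurent"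
  where "laurent g = (\<Sum>m\<in>keys g. single (int_exp m) (lookup g m))"

lemma lookup_laurent:
  "lookup (laurent g) a = (\<Sum>m\<in>keys g. if int_exp m = a then lookup g m else 0)"
  by (simp add: laurent_def lookup_sum lookup_single when_def)

lemma lookup_laurent_int_exp [simp]: "lookup (laurent g) (int_exp m) = lookup g m"
  by (simp add: lookup_laurent sum.delta in_keys_iff)

lemma lookup_laurent_outside: "a \<notin> range int_exp \<Longrightarrow> lookup (laurent g) a = 0"
  by (auto simp: lookup_laurent intro!: sum.neutral)

lemma keys_laurent: "keys (laurent g) = int_exp ` keys g"
proof -
  have "a \<in> int_exp ` keys g" if *: "a \<in> keys (laurent g)" for a
  proof -
    have "a \<in> range int_exp" using * lookup_laurent_outside[of a g] by (metis in_keys_iff)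
    then show ?thesis using * by (auto simp: in_keys_iff)
  qed
  then show ?thesis by (auto simp: in_keys_iff)
qed

lemma laurent_eqI:
  assumes "\<And>m. lookup h (int_exp m) = lookup g m" "\<And>a. a \<notin> range int_exp \<Longrightarrow> lookup h a = 0"
  shows "laurent g = h"
proof (rule poly_mapping_eqI)
  fix a show "lookup (laurent g) a = lookup h a"
    using assms lookup_laurent_outside[of a g] by (cases "a \<in> range int_exp") auto
qed

lemma laurent_add: "laurent (g + h) = laurent g + laurent h"
  by (rule laurent_eqI) (auto simp: lookup_add lookup_laurent_outside)

lemma laurent_zero [simp]: "laurent 0 = 0"
  by (simp add: laurent_def)

lemma laurent_diff: "laurent (g - h) = laurent g - laurent h"
  by (rule laurent_eqI) (auto simp: lookup_minus lookup_laurent_outside)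

lemma laurent_sum: "laurent (sum g I) = (\<Sum>i\<in>I. laurent (g i))"
  by (induction I rule: infinite_finite_induct) (auto simp: laurent_add)

lemma laurent_single: "laurent (single m c) = single (int_exp m) c"
  by (cases "c = 0") (auto simp: laurent_def)

lemma laurent_one [simp]: "laurent 1 = 1"
  using laurent_single[of 0 1] by simp

lemma laurent_mult: "laurent (g * h) = laurent g * laurent h"
proof -
  have "g * h = (\<Sum>m\<in>keys g. single m (lookup g m)) * (\<Sum>m\<in>keys h. single m (lookup h m))"
    by (simp only: sum_monomials)
  then have "g * h = (\<Sum>m\<in>keys g. \<Sum>m'\<in>keys h. single (m + m') (lookup g m * lookup h m'))"
    by (simp only: sum_product mult_single)
  then have "laurent (g * h) =
      (\<Sum>m\<in>keys g. \<Sum>m'\<in>keys h. single (int_exp m) (lookup g m) * single (int_exp m') (lookup h m'))"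
    by (simp only: laurent_sum laurent_single int_exp_add mult_single)
  then show ?thesis
    by (simp only: laurent_def sum_product)
qed

lemma laurent_power: "laurent (g ^ n) = laurent g ^ n"
  by (induction n) (auto simp: laurent_mult)

lemma laurent_eq_iff [simp]: "laurent g = laurent h \<longleftrightarrow> g = h"
proof
  assume "laurent g = laurent h"
  then have "lookup (laurent g) (int_exp m) = lookup (laurent h) (int_exp m)" for m by simp
  then show "g = h" by (intro poly_mapping_eqI) simp
qed simp

text \<open>
  The localization of the polynomial ring at the variables with index in \<open>J\<close>, as a subring of the
  Laurent polynomials: only those variables may have negative exponents.
\<close>

definition loc :: "'v set \<Rightarrow> ('v, 'k::comm_ring_1) laurent set"
  where "loc J = {g. \<forall>a\<in>keys g. \<forall>v. lookup a v < 0 \<longrightarrow> v \<in> J}"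

lemma locD: "g \<in> loc J \<Longrightarrow> a \<in> keys g \<Longrightarrow> v \<notin> J \<Longrightarrow> 0 \<le> lookup a v"
  unfolding loc_def mem_Collect_eq by (meson not_le)

lemma loc_mono: "J \<subseteq> K \<Longrightarrow> loc J \<subseteq> loc K"
  unfolding loc_def by blast

lemma loc_zero [simp]: "0 \<in> loc J" by (simp add: loc_def)

lemma loc_UNIV [simp]: "loc UNIV = UNIV" by (simp add: loc_def)

lemma loc_add: "g \<in> loc J \<Longrightarrow> h \<in> loc J \<Longrightarrow> g + h \<in> loc J"
  using subsetD[OF Poly_Mapping.keys_add, of _ g h] by (auto simp: loc_def)

lemma loc_uminus [simp]: "- g \<in> loc J \<longleftrightarrow> g \<in> loc J"
  by (simp add: loc_def)

lemma loc_diff: "g \<in> loc J \<Longrightarrow> h \<in> loc J \<Longrightarrow> g - h \<in> loc J"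
  using loc_add[of g J "- h"] by simp

lemma loc_sum: "(\<And>i. i \<in> I \<Longrightarrow> g i \<in> loc J) \<Longrightarrow> sum g I \<in> loc J"
  by (induction I rule: infinite_finite_induct) (auto simp: loc_add)

lemma loc_mult:
  assumes "g \<in> loc J" "h \<in> loc J" shows "g * h \<in> loc J"
  unfolding loc_def
proof (intro CollectI ballI allI impI)
  fix a v assume a: "a \<in> keys (g * h)" and *: "lookup a v < 0"
  obtain b c where "a = b + c" "b \<in> keys g" "c \<in> keys h"
    using subsetD[OF keys_mult a] by blast
  show "v \<in> J"
  proof (rule ccontr)
    assume "v \<notin> J"
    then have "0 \<le> lookup b v" "0 \<le> lookup c v"
      by (rule locD[OF assms(1) \<open>b \<in> keys g\<close>], rule locD[OF assms(2) \<open>c \<in> keys h\<close>])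
    then show False using * \<open>a = b + c\<close> by (simp add: lookup_add)
  qed
qed

lemma loc_laurent [simp]: "laurent g \<in> loc J"
  by (auto simp: loc_def keys_laurent)

lemma loc_one [simp]: "1 \<in> loc J"
  using loc_laurent[of 1] by simp

lemma loc_power: "g \<in> loc J \<Longrightarrow> g ^ n \<in> loc J"
  by (induction n) (auto simp: loc_mult)

lemma loc_project: "g \<in> loc J \<Longrightarrow> project P g \<in> loc J"
  by (auto simp: loc_def keys_project)

lemma loc_empty: "loc {} = range (laurent :: ('v, 'k::comm_ring_1) mpoly \<Rightarrow> _)"
proof (intro equalityI subsetI)
  fix g :: "('v, 'k) laurent" assume g: "g \<in> loc {}"
  have "keys g \<subseteq> range int_exp"
  proof
    fix a assume "a \<in> keys g"
    then show "a \<in> range int_exp" unfolding range_int_exp using locD[OF g] by blast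
  qed
  have inj: "inj (int_exp :: ('v \<Rightarrow>\<^sub>0 nat) \<Rightarrow> _)" by (simp add: inj_def)
  have "laurent (Poly_Mapping.map_key int_exp g) = g"
  proof (rule laurent_eqI)
    show "lookup g (int_exp m) = lookup (Poly_Mapping.map_key int_exp g) m" for m
      using inj by (simp add: map_key.rep_eq)
    show "lookup g a = 0" if "a \<notin> range int_exp" for a
      using that \<open>keys g \<subseteq> range int_exp\<close> by (metis in_keys_iff subsetD)
  qed
  then show "g \<in> range laurent" by (metis rangeI)
qed auto

definition total_degree :: "('v::finite \<Rightarrow>\<^sub>0 int) \<Rightarrow> int"
  where "total_degree a = (\<Sum>v\<in>UNIV. lookup a v)"

lemma total_degree_add [simp]: "total_degree (a + b) = total_degree a + total_degree b"
  by (simp add: total_degree_def lookup_add sum.distrib)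

lemma total_degree_minus [simp]: "total_degree (a - b) = total_degree a - total_degree b"
  by (simp add: total_degree_def lookup_minus sum_subtractf)

lemma keys_power_total_degree:
  assumes "\<forall>a\<in>keys (g :: ('v::finite, 'k::comm_ring_1) laurent). total_degree a = i"
  shows "\<forall>a\<in>keys (g ^ n). total_degree a = int n * i"
proof (induction n)
  case (Suc n)
  show ?case
  proof
    fix a assume "a \<in> keys (g ^ Suc n)"
    then obtain b c where "a = b + c" "b \<in> keys g" "c \<in> keys (g ^ n)"
      using subsetD[OF keys_mult, of a g "g ^ n"] by auto
    then show "total_degree a = int (Suc n) * i" using Suc assms by (simp add: algebra_simps)
  qed
qed (auto simp: total_degree_def)

lemma homogeneous_polys_iff:
  "g \<in> homogeneous_polys i \<longleftrightarrow> (\<forall>a\<in>keys (laurent g). total_degree a = i)"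
  by (auto simp: homogeneous_polys_def keys_laurent total_degree_def)

text \<open>
  The exponent of \<open>v\<close> in the denominator is the sum of the orders of the poles along \<open>v\<close> of all the monomials
  of \<open>g\<close>; this is at least the order of each of them.
\<close>

lemma clear_denominators:
  fixes g :: "('v::finite, 'k::comm_ring_1) laurent"
  assumes "g \<in> loc J"
  obtains r m where "keys m \<subseteq> J" "g * single (int_exp m) 1 = laurent r"
proof -
  define M where "M v = (\<Sum>a\<in>keys g. nat (- lookup a v))" for v
  define m where "m = (\<Sum>v\<in>J. single v (M v))"
  have lm: "lookup m v = (M v when v \<in> J)" for v
    by (simp add: m_def lookup_sum lookup_single when_def sum.delta)
  have "g * single (int_exp m) 1 \<in> loc {}"
    unfolding loc_def
  proof (intro CollectI ballI allI impI)
    fix b v assume "b \<in> keys (g * single (int_exp m) 1)" and neg: "lookup b v < 0"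
    then obtain a where a: "a \<in> keys g" "b = int_exp m + a"
      using keys_single_times[of "int_exp m" g] by (auto simp: mult.commute)
    have "lookup a v < 0" using neg a(2) by (simp add: lookup_add)
    then have "v \<in> J" using assms a(1) unfolding loc_def by blast
    have "nat (- lookup a v) \<le> M v" unfolding M_def using a(1) by (intro member_le_sum) auto
    then show "v \<in> {}" using neg a \<open>v \<in> J\<close> by (simp add: lookup_add lm)
  qed
  then obtain r where "g * single (int_exp m) 1 = laurent r" unfolding loc_empty by auto
  moreover have "keys m \<subseteq> J" by (auto simp: in_keys_iff lm when_def split: if_splits)
  ultimately show ?thesis using that by blast
qed

lemma loc_single: "keys m \<subseteq> J \<Longrightarrow> single (- int_exp m) c \<in> loc J"
proof -
  assume J: "keys m \<subseteq> J"
  have "v \<in> J" if "a \<in> keys (single (- int_exp m) c)" "lookup a v < 0" for a v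
  proof -
    have "a = - int_exp m" using that(1) by (simp split: if_splits)
    then have "lookup m v \<noteq> 0" using that(2) by simp
    then show ?thesis using J by (auto simp: in_keys_iff)
  qed
  then show ?thesis by (simp add: loc_def)
qed

section \<open>Splittings of the Frobenius\<close>

definition scale_exp :: "nat \<Rightarrow> ('v \<Rightarrow>\<^sub>0 int) \<Rightarrow> ('v \<Rightarrow>\<^sub>0 int)"
  where "scale_exp n = Poly_Mapping.map ((*) (int n))"

lemma lookup_scale_exp [simp]: "lookup (scale_exp n a) v = int n * lookup a v"
  by (simp add: scale_exp_def Poly_Mapping.map.rep_eq when_def)

lemma inj_scale_exp: "p > 0 \<Longrightarrow> scale_exp p a = scale_exp p a' \<longleftrightarrow> a = a'"
  by (auto simp: poly_mapping_eq_iff fun_eq_iff)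

lemma power_single: "single a (c :: 'b::comm_semiring_1) ^ n = single (scale_exp n a) (c ^ n)"
proof (induction n)
  case 0
  have "scale_exp 0 a = 0" by (rule poly_mapping_eqI) simp
  then show ?case by simp
next
  case (Suc n)
  have "scale_exp (Suc n) a = a + scale_exp n a"
    by (rule poly_mapping_eqI) (simp add: lookup_add algebra_simps)
  with Suc show ?case by (simp add: mult_single)
qed

lemma power_CHAR_eq_sum:
  fixes u :: "('v, 'k::comm_ring_1) laurent"
  assumes "Factorial_Ring.prime p" "p = CHAR('k)"
  shows "u ^ p = (\<Sum>m\<in>keys u. single (scale_exp p m) (lookup u m ^ p))"
proof -
  have "u ^ p = (\<Sum>m\<in>keys u. single m (lookup u m)) ^ p"
    by (simp only: sum_monomials)
  also have "\<dots> = (\<Sum>m\<in>keys u. single m (lookup u m) ^ p)"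
    using assms by (intro freshmans_dream_sum) simp_all
  finally show ?thesis by (simp only: power_single)
qed

lemma lookup_power_CHAR:
  fixes u :: "('v, 'k::comm_ring_1) laurent"
  assumes "Factorial_Ring.prime p" "p = CHAR('k)"
  shows "lookup (u ^ p) (scale_exp p m) = lookup u m ^ p"
    and "x \<notin> range (scale_exp p) \<Longrightarrow> lookup (u ^ p) x = 0"
proof -
  have p: "p > 0" using assms(1) prime_gt_0_nat by blast
  have *: "lookup (u ^ p) x = (\<Sum>m\<in>keys u. if scale_exp p m = x then lookup u m ^ p else 0)" for x
    by (simp only: power_CHAR_eq_sum[OF assms] lookup_sum lookup_single when_def)
  have "lookup (u ^ p) (scale_exp p m) = (\<Sum>k\<in>keys u. if k = m then lookup u k ^ p else 0)"
    unfolding * using p by (simp only: inj_scale_exp)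
  then show "lookup (u ^ p) (scale_exp p m) = lookup u m ^ p"
    using p by (simp add: sum.delta in_keys_iff zero_power)
  show "lookup (u ^ p) x = 0" if "x \<notin> range (scale_exp p)"
    unfolding * using that by (intro sum.neutral) auto
qed

text \<open>
  The additive maps \<open>\<phi>\<close> that are linear over \<open>p\<close>-th powers with a root extracted from the result.
  The coordinate functions of a basis of \<open>k\<close> over \<open>k\<^sup>p\<close>, followed by the \<open>p\<close>-th root, are the examples needed.
\<close>

definition frob_linear :: "nat \<Rightarrow> ('k::comm_ring_1 \<Rightarrow> 'k) \<Rightarrow> bool"
  where "frob_linear p \<phi> \<longleftrightarrow> (\<forall>x y. \<phi> (x + y) = \<phi> x + \<phi> y) \<and> (\<forall>c x. \<phi> (c ^ p * x) = c * \<phi> x)"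

lemma frob_linear_zero: "frob_linear p \<phi> \<Longrightarrow> \<phi> 0 = 0"
  unfolding frob_linear_def by (metis add_cancel_right_left)

definition digits :: "nat \<Rightarrow> ('v \<Rightarrow>\<^sub>0 int) set"
  where "digits p = {b. \<forall>v. 0 \<le> lookup b v \<and> lookup b v < int p}"

text \<open>
  This is the extension of \<open>\<phi>\<close> to Laurent polynomials that sends \<open>c x\<^sup>b\<^sup>+\<^sup>p\<^sup>a\<close> to \<open>\<phi>(c) x\<^sup>a\<close> and annihilates the other
  residue classes of exponents modulo \<open>p\<close>. With \<open>b\<close> among the digits and \<open>\<phi>\<close> a rooted coordinate
  function, it is the \<open>p\<close>-th root of a coordinate with respect to the basis of monomials \<open>e x\<^sup>b\<close> over the \<open>p\<close>-th powers.
\<close>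

definition frob_root :: "nat \<Rightarrow> ('k \<Rightarrow> 'k) \<Rightarrow> ('v \<Rightarrow>\<^sub>0 int) \<Rightarrow> ('v, 'k::comm_ring_1) laurent \<Rightarrow> ('v, 'k) laurent"
  where "frob_root p \<phi> b g = Poly_Mapping.map \<phi> (Poly_Mapping.map_key (\<lambda>a. b + scale_exp p a) g)"

lemma lookup_frob_root:
  assumes "p > 0" "frob_linear p \<phi>"
  shows "lookup (frob_root p \<phi> b g) a = \<phi> (lookup g (b + scale_exp p a))"
proof -
  have "inj (\<lambda>a. b + scale_exp p a)" using assms(1) by (simp add: inj_def inj_scale_exp)
  then show ?thesis
    using frob_linear_zero[OF assms(2)]
    by (simp add: frob_root_def Poly_Mapping.map.rep_eq map_key.rep_eq when_def)
qed

lemma frob_root_add: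
  assumes "p > 0" "frob_linear p \<phi>"
  shows "frob_root p \<phi> b (g + h) = frob_root p \<phi> b g + frob_root p \<phi> b h"
  using assms(2)
  by (intro poly_mapping_eqI) (simp add: lookup_frob_root[OF assms] lookup_add frob_linear_def)

lemma frob_root_zero:
  assumes "p > 0" "frob_linear p \<phi>"
  shows "frob_root p \<phi> b 0 = 0"
  by (intro poly_mapping_eqI) (simp add: lookup_frob_root[OF assms] frob_linear_zero[OF assms(2)])

lemma frob_root_sum:
  assumes "p > 0" "frob_linear p \<phi>"
  shows "frob_root p \<phi> b (sum g I) = (\<Sum>i\<in>I. frob_root p \<phi> b (g i))"
  by (induction I rule: infinite_finite_induct)
     (simp_all add: frob_root_zero[OF assms] frob_root_add[OF assms])

text \<open>
  The projection formula \<open>\<Phi>(u\<^sup>p y) = u \<Phi>(y)\<close>. It moves a Frobenius power out of the argument, and by this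
  replaces an appeal to the flatness of the Frobenius.
\<close>

lemma frob_root_power_mult:
  fixes u y :: "('v, 'k::comm_ring_1) laurent"
  assumes "Factorial_Ring.prime p" "p = CHAR('k)" and \<phi>: "frob_linear p \<phi>"
  shows "frob_root p \<phi> b (u ^ p * y) = u * frob_root p \<phi> b y"
proof -
  have p: "p > 0" using assms(1) prime_gt_0_nat by blast
  have *: "frob_root p \<phi> b (single (scale_exp p m) (c ^ p) * y) = single m c * frob_root p \<phi> b y" for m c
  proof (rule poly_mapping_eqI)
    fix a
    have eq: "b + scale_exp p a - scale_exp p m = b + scale_exp p (a - m)"
      by (rule poly_mapping_eqI) (simp add: lookup_add lookup_minus algebra_simps)
    show "lookup (frob_root p \<phi> b (single (scale_exp p m) (c ^ p) * y)) a =
        lookup (single m c * frob_root p \<phi> b y) a"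
      unfolding lookup_frob_root[OF p \<phi>] lookup_single_times eq using \<phi> by (simp add: frob_linear_def)
  qed
  have "frob_root p \<phi> b (u ^ p * y) = (\<Sum>m\<in>keys u. single m (lookup u m)) * frob_root p \<phi> b y"
    unfolding power_CHAR_eq_sum[OF assms(1,2)] sum_distrib_right frob_root_sum[OF p \<phi>] * ..
  then show ?thesis by (simp only: sum_monomials)
qed

lemma frob_root_loc_empty:
  assumes "p > 0" "frob_linear p \<phi>" "b \<in> digits p" "g \<in> loc {}"
  shows "frob_root p \<phi> b g \<in> loc {}"
  unfolding loc_def
proof (intro CollectI ballI allI impI)
  fix a v assume "a \<in> keys (frob_root p \<phi> b g)" and neg: "lookup a v < 0"
  then have "b + scale_exp p a \<in> keys g"
    using frob_linear_zero[OF assms(2)] by (auto simp: in_keys_iff lookup_frob_root[OF assms(1,2)])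
  then have "0 \<le> lookup (b + scale_exp p a) v" using locD[OF assms(4)] by blast
  moreover have "lookup b v < int p" using assms(3) by (simp add: digits_def)
  moreover have "int p * lookup a v \<le> int p * (-1)" using neg by (intro mult_left_mono) auto
  ultimately show "v \<in> {}" by (simp add: lookup_add)
qed

text \<open>
  The submodule generated by the \<open>loc (UNIV - {i})\<close>: the quotient of all Laurent polynomials by it is the
  top local cohomology of the polynomial ring.
\<close>

definition cech_image :: "('v, 'k::comm_ring_1) laurent set"
  where "cech_image = {g. \<forall>a\<in>keys g. \<exists>v. 0 \<le> lookup a v}"

lemma cech_image_zero [simp]: "0 \<in> cech_image"
  by (simp add: cech_image_def)

lemma cech_image_add:
  assumes "g \<in> cech_image" "h \<in> cech_image" shows "g + h \<in> cech_image"
  unfolding cech_image_def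
proof (intro CollectI ballI)
  fix a assume "a \<in> keys (g + h)"
  then consider "a \<in> keys g" | "a \<in> keys h"
    using subsetD[OF Poly_Mapping.keys_add, of a g h] by (meson UnE)
  then show "\<exists>v. 0 \<le> lookup a v" by cases (use assms in \<open>simp_all add: cech_image_def\<close>)
qed

lemma cech_image_sum: "(\<And>i. i \<in> I \<Longrightarrow> g i \<in> cech_image) \<Longrightarrow> sum g I \<in> cech_image"
  by (induction I rule: infinite_finite_induct) (auto simp: cech_image_add)

lemma cech_image_laurent_mult:
  assumes "g \<in> cech_image" shows "laurent h * g \<in> cech_image"
  unfolding cech_image_def
proof (intro CollectI ballI)
  fix a assume "a \<in> keys (laurent h * g)"
  then obtain m b where ab: "a = int_exp m + b" "b \<in> keys g"
    using subsetD[OF keys_mult, of a "laurent h" g] keys_laurent[of h] by auto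
  then obtain v where "0 \<le> lookup b v" using assms by (auto simp: cech_image_def)
  then show "\<exists>v. 0 \<le> lookup a v" using ab by (intro exI[of _ v]) (simp add: lookup_add)
qed

text \<open>
  If \<open>b + p a \<ge> 0\<close> in some coordinate, then \<open>p a > -p\<close> there because the digit of \<open>b\<close> is less than \<open>p\<close>, so \<open>a \<ge> 0\<close>.
  Thus the splittings also act on the top local cohomology of the polynomial ring.
\<close>

lemma frob_root_cech_image:
  assumes "p > 0" "frob_linear p \<phi>" "b \<in> digits p" "g \<in> cech_image"
  shows "frob_root p \<phi> b g \<in> cech_image"
  unfolding cech_image_def
proof (intro CollectI ballI)
  fix a assume "a \<in> keys (frob_root p \<phi> b g)"
  then have "b + scale_exp p a \<in> keys g"
    using frob_linear_zero[OF assms(2)] by (auto simp: in_keys_iff lookup_frob_root[OF assms(1,2)])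
  then obtain v where v: "0 \<le> lookup (b + scale_exp p a) v"
    using assms(4) by (auto simp: cech_image_def)
  have "0 \<le> lookup a v"
  proof (rule ccontr)
    assume "\<not> 0 \<le> lookup a v"
    then have "int p * lookup a v \<le> int p * (-1)" by (intro mult_left_mono) auto
    moreover have "lookup b v < int p" using assms(3) by (simp add: digits_def)
    ultimately show False using v by (simp add: lookup_add)
  qed
  then show "\<exists>v. 0 \<le> lookup a v" ..
qed

definition rem_exp :: "nat \<Rightarrow> ('v \<Rightarrow>\<^sub>0 int) \<Rightarrow> ('v \<Rightarrow>\<^sub>0 int)"
  where "rem_exp p = Poly_Mapping.map (\<lambda>x. x mod int p)"

lemma lookup_rem_exp [simp]: "lookup (rem_exp p a) v = lookup a v mod int p"
  by (simp add: rem_exp_def Poly_Mapping.map.rep_eq when_def)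

lemma rem_exp_digits: "p > 0 \<Longrightarrow> rem_exp p a \<in> digits p"
  by (simp add: digits_def)

lemma exp_division:
  obtains q where "a = rem_exp p a + scale_exp p q"
proof
  show "a = rem_exp p a + scale_exp p (Poly_Mapping.map (\<lambda>x. x div int p) a)"
    by (rule poly_mapping_eqI) (simp add: lookup_add Poly_Mapping.map.rep_eq when_def)
qed

lemma rem_exp_unique:
  assumes "b \<in> digits p" "a = b + scale_exp p q" shows "rem_exp p a = b"
  using assms by (intro poly_mapping_eqI) (auto simp: digits_def lookup_add mod_pos_pos_trivial)

text \<open>
  The expansion of \<open>y\<close> in the basis \<open>e x\<^sup>b\<close> over the \<open>p\<close>-th powers. It is stated relative to a finite set \<open>E\<close> in
  which the coefficients of this particular \<open>y\<close> can be expanded.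
\<close>

lemma frob_root_reconstruction:
  fixes y :: "('v, 'k::comm_ring_1) laurent"
  assumes p: "Factorial_Ring.prime p" "p = CHAR('k)" and \<phi>: "\<And>e. frob_linear p (\<phi> e)"
    and fin: "finite B" "finite E" and B: "B \<subseteq> digits p" "\<And>a. a \<in> keys y \<Longrightarrow> rem_exp p a \<in> B"
    and E: "\<And>a. a \<in> keys y \<Longrightarrow> lookup y a = (\<Sum>e\<in>E. \<phi> e (lookup y a) ^ p * e)"
  shows "y = (\<Sum>b\<in>B. \<Sum>e\<in>E. frob_root p (\<phi> e) b y ^ p * single b e)"
proof (rule poly_mapping_eqI)
  fix a :: "'v \<Rightarrow>\<^sub>0 int"
  have p0: "p > 0" using p(1) prime_gt_0_nat by blast
  obtain q where q: "a = rem_exp p a + scale_exp p q" by (rule exp_division)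
  have one: "lookup (frob_root p (\<phi> e) b y ^ p * single b e) a
      = (if b = rem_exp p a then \<phi> e (lookup y a) ^ p * e else 0)" if "b \<in> B" for b e
  proof -
    have 1: "lookup (frob_root p (\<phi> e) b y ^ p * single b e) a
        = e * lookup (frob_root p (\<phi> e) b y ^ p) (a - b)"
      by (simp add: mult.commute[of _ "single b e"] lookup_single_times)
    show ?thesis
    proof (cases "b = rem_exp p a")
      case True
      then have "a - b = scale_exp p q" using q by (metis add_diff_cancel_left')
      moreover have "lookup (frob_root p (\<phi> e) b y) q = \<phi> e (lookup y a)"
        using q True by (simp add: lookup_frob_root[OF p0 \<phi>])
      ultimately show ?thesis
        using True unfolding 1 by (simp add: lookup_power_CHAR(1)[OF p] mult.commute)
    next
      case False
      have "a - b \<notin> range (scale_exp p)"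
      proof
        assume "a - b \<in> range (scale_exp p)"
        then obtain q' where "a - b = scale_exp p q'" by blast
        then have "a = b + scale_exp p q'" by (metis add.commute diff_add_cancel)
        then show False using rem_exp_unique subsetD[OF B(1) that] False by metis
      qed
      then show ?thesis using False unfolding 1 by (simp add: lookup_power_CHAR(2)[OF p])
    qed
  qed
  have "lookup (\<Sum>b\<in>B. \<Sum>e\<in>E. frob_root p (\<phi> e) b y ^ p * single b e) a
      = (\<Sum>b\<in>B. \<Sum>e\<in>E. if b = rem_exp p a then \<phi> e (lookup y a) ^ p * e else 0)"
    unfolding lookup_sum using one by (intro sum.cong refl) blast
  also have "\<dots> = (\<Sum>b\<in>B. if b = rem_exp p a then \<Sum>e\<in>E. \<phi> e (lookup y a) ^ p * e else 0)"
    by (intro sum.cong refl) simp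
  also have "\<dots> = (if rem_exp p a \<in> B then \<Sum>e\<in>E. \<phi> e (lookup y a) ^ p * e else 0)"
    using fin(1) by (rule sum.delta)
  also have "\<dots> = lookup y a"
  proof (cases "a \<in> keys y")
    case True
    then show ?thesis using B(2)[OF True] E[OF True] by simp
  next
    case False
    then have "lookup y a = 0" by (simp add: in_keys_iff)
    then show ?thesis using p0 frob_linear_zero[OF \<phi>] by (simp add: zero_power)
  qed
  finally show "lookup y a = lookup (\<Sum>b\<in>B. \<Sum>e\<in>E. frob_root p (\<phi> e) b y ^ p * single b e) a"
    by (rule sym)
qed

text \<open>
  The field is a vector space over itself through \<open>c \<cdot> x = c\<^sup>p x\<close>, which is \<open>k\<close> over \<open>k\<^sup>p\<close> with the scalars renamed;
  in this form the coordinate functions of a basis already have the \<open>p\<close>-th root extracted.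
\<close>

lemma p_basis:
  fixes C :: "'k::field set"
  assumes "Factorial_Ring.prime p" "p = CHAR('k)" "finite C"
  obtains E \<phi> where "finite E" "\<And>e. frob_linear p (\<phi> e)" "\<And>c. c \<in> C \<Longrightarrow> c = (\<Sum>e\<in>E. \<phi> e c ^ p * e)"
proof -
  define sc :: "'k \<Rightarrow> 'k \<Rightarrow> 'k" where "sc c x = c ^ p * x" for c x
  interpret V: Vector_Spaces.vector_space sc
  proof
    show "sc (a + b) x = sc a x + sc b x" for a b x
      using freshmans_dream[of p a b] assms by (simp add: sc_def distrib_right)
  qed (simp_all add: sc_def algebra_simps power_mult_distrib)
  define B where "B = V.extend_basis {}"
  have B: "V.independent B" "V.span B = UNIV"
    unfolding B_def using V.independent_extend_basis V.span_extend_basis V.independent_empty by auto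
  define \<phi> where "\<phi> e c = V.representation B c e" for e c
  define E where "E = (\<Union>c\<in>C. {e. \<phi> e c \<noteq> 0})"
  show ?thesis
  proof
    show "finite E"
      unfolding E_def \<phi>_def using assms(3) V.finite_representation by blast
    show "frob_linear p (\<phi> e)" for e
      unfolding frob_linear_def
    proof (intro conjI allI)
      show "\<phi> e (x + y) = \<phi> e x + \<phi> e y" for x y
        using V.representation_add[of B y x] B by (simp add: \<phi>_def)
      show "\<phi> e (c ^ p * x) = c * \<phi> e x" for c x
        using V.representation_scale[of B x c] B by (simp add: \<phi>_def sc_def)
    qed
    show "c = (\<Sum>e\<in>E. \<phi> e c ^ p * e)" if "c \<in> C" for c
    proof -
      have "(\<Sum>e\<in>E. \<phi> e c ^ p * e) = (\<Sum>e | \<phi> e c \<noteq> 0. \<phi> e c ^ p * e)"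
        using \<open>finite E\<close> that prime_gt_0_nat[OF assms(1)]
        by (intro sum.mono_neutral_right) (auto simp: E_def)
      also have "\<dots> = c"
        using V.sum_nonzero_representation_eq[of B c] B by (simp add: \<phi>_def sc_def)
      finally show ?thesis by simp
    qed
  qed
qed

section \<open>The test ideal\<close>

lemma ring_of_type_algebra_simps [simp]:
  fixes x y :: "'a::comm_ring_1"
  shows "carrier (ring_of_type_algebra :: 'a ring) = UNIV"
    and "x \<otimes>\<^bsub>ring_of_type_algebra\<^esub> y = x * y" and "x \<oplus>\<^bsub>ring_of_type_algebra\<^esub> y = x + y"
    and "\<one>\<^bsub>ring_of_type_algebra\<^esub> = (1 :: 'a)" and "\<zero>\<^bsub>ring_of_type_algebra\<^esub> = (0 :: 'a)"
  by (simp_all add: ring_of_type_algebra_def)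

lemma ring_of_type_algebra_pow [simp]:
  "(x :: 'a::comm_ring_1) [^]\<^bsub>ring_of_type_algebra\<^esub> (n :: nat) = x ^ n"
  by (induction n) (simp_all add: mult.commute)

lemma ring_of_type_algebra_a_inv [simp]:
  "\<ominus>\<^bsub>ring_of_type_algebra\<^esub> x = - (x :: 'a::comm_ring_1)"
proof -
  interpret cring "ring_of_type_algebra :: 'a ring" ..
  show ?thesis by (rule minus_equality) auto
qed

lemma ideal_type_algebra_iff:
  "ideal I (ring_of_type_algebra :: 'a::comm_ring_1 ring) \<longleftrightarrow>
    0 \<in> I \<and> (\<forall>x\<in>I. \<forall>y\<in>I. x + y \<in> I) \<and> (\<forall>x\<in>I. \<forall>r. r * x \<in> I)" (is "_ \<longleftrightarrow> ?R")
proof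
  interpret cring "ring_of_type_algebra :: 'a ring" ..
  assume "ideal I (ring_of_type_algebra :: 'a ring)"
  then interpret ideal I "ring_of_type_algebra :: 'a ring" .
  show ?R using zero_closed a_closed I_l_closed by simp
next
  interpret cring "ring_of_type_algebra :: 'a ring" ..
  assume R: ?R
  show "ideal I (ring_of_type_algebra :: 'a ring)"
  proof (rule idealI[OF ring_axioms])
    show "subgroup I (add_monoid (ring_of_type_algebra :: 'a ring))"
    proof (rule add.subgroupI)
      show "\<ominus>\<^bsub>ring_of_type_algebra\<^esub> a \<in> I" if "a \<in> I" for a
        using R[THEN conjunct2, THEN conjunct2, rule_format, OF that, of "-1"] by simp
    qed (use R in auto)
  qed (use R in \<open>auto simp: mult.commute\<close>)
qed

lemma ideal_sum:
  fixes g :: "'i \<Rightarrow> 'a::comm_ring_1"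
  assumes "ideal I ring_of_type_algebra" "\<And>i. i \<in> A \<Longrightarrow> g i \<in> I"
  shows "sum g A \<in> I"
  using assms(2) assms(1)[unfolded ideal_type_algebra_iff]
  by (induction A rule: infinite_finite_induct) auto

text \<open>
  If \<open>h = \<Sum> r\<^sub>i u\<^sub>i\<^sup>p\<close> with \<open>u\<^sub>i \<in> I\<close>, then \<open>\<Phi>(h) = \<Sum> u\<^sub>i \<Phi>(r\<^sub>i) \<in> I\<close> by the projection formula.
\<close>

lemma frob_root_frobenius_power:
  fixes I :: "('v::{finite,linorder}, 'k::field) mpoly set"
  assumes p: "Factorial_Ring.prime p" "p = CHAR('k)" and I: "ideal I mpoly_ring"
    and h: "h \<in> frobenius_power mpoly_ring p 1 I" and \<phi>: "frob_linear p \<phi>" "b \<in> digits p"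
  shows "frob_root p \<phi> b (laurent h) \<in> laurent ` I"
proof -
  interpret R: cring "mpoly_ring :: ('v, 'k) mpoly ring" ..
  have p0: "p > 0" using p(1) prime_gt_0_nat by blast
  have I': "0 \<in> I" "\<And>x y. x \<in> I \<Longrightarrow> y \<in> I \<Longrightarrow> x + y \<in> I" "\<And>x r. x \<in> I \<Longrightarrow> r * x \<in> I"
    using I by (auto simp: ideal_type_algebra_iff)
  \<comment> \<open>The quantifier over \<open>r\<close> makes \<open>J\<close> an ideal, so that it suffices to look at the generators \<open>u ^ p\<close>.\<close>
  define J where "J = {y. \<forall>r. frob_root p \<phi> b (laurent (r * y)) \<in> laurent ` I}"
  have "ideal J mpoly_ring"
    unfolding ideal_type_algebra_iff
  proof (intro conjI ballI allI)
    show "0 \<in> J" using I'(1) by (auto simp: J_def frob_root_zero[OF p0 \<phi>(1)] intro!: image_eqI[of _ _ 0])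
    show "x + y \<in> J" if "x \<in> J" "y \<in> J" for x y
    proof -
      have "frob_root p \<phi> b (laurent (r * (x + y))) \<in> laurent ` I" for r
      proof -
        have "frob_root p \<phi> b (laurent (r * x)) \<in> laurent ` I" "frob_root p \<phi> b (laurent (r * y)) \<in> laurent ` I"
          using that by (simp_all add: J_def)
        then obtain c d where "c \<in> I" "d \<in> I" "frob_root p \<phi> b (laurent (r * x)) = laurent c"
          "frob_root p \<phi> b (laurent (r * y)) = laurent d"
          by (elim imageE)
        then show ?thesis
          by (intro image_eqI[of _ _ "c + d"])
             (simp_all add: distrib_left laurent_add frob_root_add[OF p0 \<phi>(1)] I'(2))
      qed
      then show ?thesis by (simp add: J_def)
    qed
    show "r * x \<in> J" if "x \<in> J" for r x
      using that by (simp add: J_def flip: mult.assoc)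
  qed
  moreover have "(\<lambda>u. u [^]\<^bsub>mpoly_ring\<^esub> (p ^ 1)) ` I \<subseteq> J"
  proof
    fix y assume "y \<in> (\<lambda>u. u [^]\<^bsub>mpoly_ring\<^esub> (p ^ 1)) ` I"
    then obtain u where u: "u \<in> I" "y = u ^ p" by auto
    have "frob_root p \<phi> b (laurent (r * y)) \<in> laurent ` I" for r
    proof -
      have "frob_root p \<phi> b (laurent r) \<in> loc {}"
        by (rule frob_root_loc_empty[OF p0 \<phi>]) simp
      then obtain c where "frob_root p \<phi> b (laurent r) = laurent c"
        unfolding loc_empty by blast
      then have "frob_root p \<phi> b (laurent (r * y)) = laurent (c * u)"
        using frob_root_power_mult[OF p \<phi>(1), of b "laurent u" "laurent r"]
        by (simp add: u(2) laurent_mult laurent_power mult.commute)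
      then show ?thesis using I'(3)[OF u(1)] by blast
    qed
    then show "y \<in> J" by (simp add: J_def)
  qed
  ultimately have "frobenius_power mpoly_ring p 1 I \<subseteq> J"
    unfolding frobenius_power_def by (rule R.genideal_minimal)
  then have "frob_root p \<phi> b (laurent (1 * h)) \<in> laurent ` I"
    using h unfolding J_def by blast
  then show ?thesis by simp
qed

definition frob_root_set :: "nat \<Rightarrow> ('v, 'k::comm_ring_1) mpoly \<Rightarrow> ('v, 'k) mpoly set"
  where "frob_root_set p h =
    {c. \<exists>\<phi> b. frob_linear p \<phi> \<and> b \<in> digits p \<and> laurent c = frob_root p \<phi> b (laurent h)}"

lemma frob_root_set_memI:
  assumes "p > 0" "frob_linear p \<phi>" "b \<in> digits p"
  obtains c where "c \<in> frob_root_set p h" "laurent c = frob_root p \<phi> b (laurent h)"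
proof -
  have "frob_root p \<phi> b (laurent h) \<in> loc {}"
    by (rule frob_root_loc_empty[OF assms]) simp
  then obtain c where c: "frob_root p \<phi> b (laurent h) = laurent c"
    unfolding loc_empty by blast
  then have "c \<in> frob_root_set p h"
    unfolding frob_root_set_def using assms by (intro CollectI exI[of _ \<phi>] exI[of _ b]) simp
  then show ?thesis using c by (intro that[of c]) simp_all
qed

text \<open>
  The reconstruction formula writes \<open>h\<close> as a combination of the \<open>p\<close>-th powers of its roots.
\<close>

lemma mem_frobenius_power_frob_roots:
  fixes h :: "('v::{finite,linorder}, 'k::field) mpoly"
  assumes p: "Factorial_Ring.prime p" "p = CHAR('k)"
  shows "h \<in> frobenius_power mpoly_ring p 1 (Idl\<^bsub>mpoly_ring\<^esub> (frob_root_set p h))"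
proof -
  interpret R: cring "mpoly_ring :: ('v, 'k) mpoly ring" ..
  have p0: "p > 0" using p(1) prime_gt_0_nat by blast
  define T where "T = Idl\<^bsub>mpoly_ring\<^esub> (frob_root_set p h)"
  have T: "frob_root_set p h \<subseteq> T" unfolding T_def by (rule R.genideal_self) simp
  define P where "P = frobenius_power mpoly_ring p 1 T"
  have P_ideal: "ideal P mpoly_ring" and pow: "(\<lambda>u. u ^ p) ` T \<subseteq> P"
    unfolding P_def frobenius_power_def
    using R.genideal_ideal[of "(\<lambda>u. u ^ p) ` T"] R.genideal_self[of "(\<lambda>u. u ^ p) ` T"] by simp_all
  have P_mult: "\<And>x r. x \<in> P \<Longrightarrow> r * x \<in> P"
    using P_ideal by (simp add: ideal_type_algebra_iff)
  define y where "y = laurent h"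
  define B where "B = rem_exp p ` keys y"
  obtain E :: "'k set" and \<phi> where E: "finite E" "\<And>e. frob_linear p (\<phi> e)"
    "\<And>c. c \<in> lookup y ` keys y \<Longrightarrow> c = (\<Sum>e\<in>E. \<phi> e c ^ p * e)"
    using p_basis[OF p, of "lookup y ` keys y"] by auto
  have y: "y = (\<Sum>b\<in>B. \<Sum>e\<in>E. frob_root p (\<phi> e) b y ^ p * single b e)"
  proof (rule frob_root_reconstruction[OF p E(2) _ E(1)])
    show "lookup y a = (\<Sum>e\<in>E. \<phi> e (lookup y a) ^ p * e)" if "a \<in> keys y" for a
      by (rule E(3)) (use that in blast)
  qed (auto simp: B_def rem_exp_digits[OF p0])
  have "\<exists>r\<in>P. frob_root p (\<phi> e) b y ^ p * single b e = laurent r" if "b \<in> B" for b e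
  proof -
    have b: "b \<in> digits p" using that by (auto simp: B_def rem_exp_digits[OF p0])
    then have "b \<in> range int_exp" unfolding range_int_exp digits_def by simp
    then obtain b' where b': "b = int_exp b'" by blast
    obtain c where c: "c \<in> frob_root_set p h" "laurent c = frob_root p (\<phi> e) b y"
      unfolding y_def using frob_root_set_memI[OF p0 E(2) b] by blast
    have "c ^ p \<in> P" using pow T c(1) by blast
    then have "single b' e * c ^ p \<in> P" by (rule P_mult)
    moreover have "frob_root p (\<phi> e) b y ^ p * single b e = laurent (single b' e * c ^ p)"
      by (simp add: laurent_mult laurent_power laurent_single c(2) b' mult.commute)
    ultimately show ?thesis by blast
  qed
  then obtain r where r: "\<And>b e. b \<in> B \<Longrightarrow> r b e \<in> P"
    "\<And>b e. b \<in> B \<Longrightarrow> frob_root p (\<phi> e) b y ^ p * single b e = laurent (r b e)"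
    by metis
  have "laurent h = laurent (\<Sum>b\<in>B. \<Sum>e\<in>E. r b e)"
    using y r(2) unfolding laurent_sum y_def[symmetric] by (simp cong: sum.cong)
  then have "h = (\<Sum>b\<in>B. \<Sum>e\<in>E. r b e)" by (simp only: laurent_eq_iff)
  also have "\<dots> \<in> P"
    by (intro ideal_sum[OF P_ideal] r(1))
  finally show ?thesis by (simp only: P_def T_def)
qed

text \<open>
  This also shows that the smallest ideal in the definition of the test ideal exists.
\<close>

lemma test_ideal_eq:
  fixes f :: "('v::{finite,linorder}, 'k::field) mpoly"
  assumes p: "Factorial_Ring.prime p" "p = CHAR('k)"
  shows "test_ideal mpoly_ring p f = Idl\<^bsub>mpoly_ring\<^esub> (frob_root_set p (f ^ (p - 1)))"
proof -
  interpret R: cring "mpoly_ring :: ('v, 'k) mpoly ring" ..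
  show ?thesis
    unfolding test_ideal_def
  proof (rule Least_equality)
    show "ideal (Idl\<^bsub>mpoly_ring\<^esub> (frob_root_set p (f ^ (p - 1)))) mpoly_ring \<and>
      f [^]\<^bsub>mpoly_ring\<^esub> (p - 1) \<in> frobenius_power mpoly_ring p 1 (Idl\<^bsub>mpoly_ring\<^esub> (frob_root_set p (f ^ (p - 1))))"
      using R.genideal_ideal mem_frobenius_power_frob_roots[OF p] by simp
    fix I assume I: "ideal I mpoly_ring \<and> f [^]\<^bsub>mpoly_ring\<^esub> (p - 1) \<in> frobenius_power mpoly_ring p 1 I"
    show "Idl\<^bsub>mpoly_ring\<^esub> (frob_root_set p (f ^ (p - 1))) \<le> I"
    proof (rule R.genideal_minimal)
      show "frob_root_set p (f ^ (p - 1)) \<subseteq> I"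
      proof
        fix c assume "c \<in> frob_root_set p (f ^ (p - 1))"
        then obtain \<phi> b where "frob_linear p \<phi>" "b \<in> digits p"
          "laurent c = frob_root p \<phi> b (laurent (f ^ (p - 1)))"
          unfolding frob_root_set_def by blast
        then have "laurent c \<in> laurent ` I"
          using frob_root_frobenius_power[OF p, of I "f ^ (p - 1)" \<phi> b] I by simp
        then show "c \<in> I" by auto
      qed
    qed (use I in blast)
  qed
qed

lemma monomial_in_irrelevant_power:
  fixes m :: "'v::{finite,linorder} \<Rightarrow>\<^sub>0 nat"
  assumes "(\<Sum>v\<in>UNIV. lookup m v) = j"
  shows "(single m 1 :: ('v, 'k::field) mpoly) \<in> irrelevant_ideal [^]\<^bsub>ideals_set mpoly_ring\<^esub> j"
  using assms
proof (induction j arbitrary: m)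
  case 0
  then show ?case by (simp add: ideals_set_def)
next
  case (Suc j)
  interpret R: cring "mpoly_ring :: ('v, 'k) mpoly ring" ..
  obtain v where v: "lookup m v > 0"
    using Suc.prems by (metis gr0I sum.neutral nat.distinct(1))
  define m' where "m' = m - single v 1"
  have m: "m = m' + single v 1"
    using v by (intro poly_mapping_eqI) (auto simp: m'_def lookup_add lookup_minus lookup_single when_def)
  have "(\<Sum>u\<in>UNIV. lookup m u) = (\<Sum>u\<in>UNIV. lookup m' u) + 1"
    unfolding m by (simp add: lookup_add sum.distrib lookup_single when_def sum.delta)
  then have "(single m' 1 :: ('v, 'k) mpoly) \<in> irrelevant_ideal [^]\<^bsub>ideals_set mpoly_ring\<^esub> j"
    using Suc by simp
  moreover have "(mpoly_var v :: ('v, 'k) mpoly) \<in> irrelevant_ideal"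
    unfolding irrelevant_ideal_def using R.genideal_self[of "range mpoly_var"] by auto
  moreover have "(single m 1 :: ('v, 'k) mpoly) = single m' 1 * mpoly_var v"
    unfolding m mpoly_var_def mult_single by simp
  ultimately show ?case
    using ideal_prod.prod[of "single m' 1" _ "mpoly_var v" irrelevant_ideal mpoly_ring]
    by (simp add: ideals_set_def)
qed

lemma exists_exponent_below:
  fixes b :: "'v::finite \<Rightarrow> nat"
  assumes "j \<le> (\<Sum>v\<in>UNIV. b v)"
  obtains m where "\<And>v. lookup m v \<le> b v" "(\<Sum>v\<in>UNIV. lookup m v) = j"
proof -
  have "\<exists>m. (\<forall>v. lookup m v \<le> b v) \<and> (\<Sum>v\<in>UNIV. lookup m v) = j"
    using assms
  proof (induction j)
    case 0
    then show ?case by (intro exI[of _ 0]) simp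
  next
    case (Suc j)
    then obtain m where m: "\<And>v. lookup m v \<le> b v" "(\<Sum>v\<in>UNIV. lookup m v) = j"
      by auto
    have "\<exists>v. lookup m v < b v"
    proof (rule ccontr)
      assume "\<nexists>v. lookup m v < b v"
      then have "(\<Sum>v\<in>UNIV. b v) \<le> (\<Sum>v\<in>UNIV. lookup m v)" by (intro sum_mono) (simp add: not_less)
      then show False using m(2) Suc.prems by simp
    qed
    then obtain v where v: "lookup m v < b v" ..
    show ?case
    proof (intro exI[of _ "m + single v 1"] conjI allI)
      show "lookup (m + single v 1) u \<le> b u" for u
        using v m(1)[of u] by (auto simp: lookup_add lookup_single when_def)
      show "(\<Sum>u\<in>UNIV. lookup (m + single v 1) u) = Suc j"
        using m(2) by (simp add: lookup_add sum.distrib lookup_single when_def sum.delta)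
    qed
  qed
  then show ?thesis using that by blast
qed

text \<open>
  The statement about the polynomial ring behind the theorem: on classes \<open>g\<close> in the top local cohomology
  of degree less than \<open>-n-j\<close>, the map \<open>g \<mapsto> f\<^sup>p\<^sup>-\<^sup>1 g\<^sup>p\<close> is injective. The annihilator of the class of \<open>g\<close> contains all roots of \<open>f\<^sup>p\<^sup>-\<^sup>1\<close>,
  hence the test ideal \<open>\<mm>\<^sup>j\<close>.
\<close>

lemma frobenius_twist_injective:
  fixes f :: "('v::{finite,linorder}, 'k::field) mpoly" and g :: "('v, 'k) laurent"
  assumes p: "Factorial_Ring.prime p" "p = CHAR('k)" and card: "card (UNIV :: 'v set) = n + 1"
    and test: "test_ideal mpoly_ring p f = irrelevant_ideal [^]\<^bsub>ideals_set mpoly_ring\<^esub> j"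
    and total_degree: "\<And>a. a \<in> keys g \<Longrightarrow> total_degree a < - int n - int j"
    and zero: "laurent (f ^ (p - 1)) * g ^ p \<in> cech_image"
  shows "g \<in> cech_image"
proof -
  interpret R: cring "mpoly_ring :: ('v, 'k) mpoly ring" ..
  have p0: "p > 0" using p(1) prime_gt_0_nat by blast
  define A where "A = {h. laurent h * g \<in> cech_image}"
  have "ideal A mpoly_ring"
    unfolding ideal_type_algebra_iff A_def
    by (auto simp: laurent_add laurent_mult distrib_right mult.assoc
        intro: cech_image_add cech_image_laurent_mult)
  moreover have "frob_root_set p (f ^ (p - 1)) \<subseteq> A"
  proof
    fix c assume "c \<in> frob_root_set p (f ^ (p - 1))"
    then obtain \<phi> b where \<phi>: "frob_linear p \<phi>" "b \<in> digits p"
      "laurent c = frob_root p \<phi> b (laurent (f ^ (p - 1)))"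
      unfolding frob_root_set_def by blast
    have "frob_root p \<phi> b (g ^ p * laurent (f ^ (p - 1))) \<in> cech_image"
      by (rule frob_root_cech_image[OF p0 \<phi>(1,2)]) (use zero in \<open>simp add: mult.commute\<close>)
    then show "c \<in> A"
      unfolding frob_root_power_mult[OF p \<phi>(1)] \<phi>(3)[symmetric] A_def by (simp add: mult.commute)
  qed
  ultimately have "test_ideal mpoly_ring p f \<subseteq> A"
    unfolding test_ideal_eq[OF p] by (rule R.genideal_minimal)
  then have mono: "laurent (single m 1) * g \<in> cech_image" if "(\<Sum>v\<in>UNIV. lookup m v) = j" for m
    using monomial_in_irrelevant_power[OF that] unfolding test A_def by blast
  show ?thesis
    unfolding cech_image_def
  proof (intro CollectI ballI, rule ccontr)
    fix a assume a: "a \<in> keys g" and "\<nexists>v. 0 \<le> lookup a v"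
    then have neg: "lookup a v < 0" for v by (meson not_le)
    have "int (\<Sum>v\<in>UNIV. nat (- lookup a v - 1)) = (\<Sum>v\<in>UNIV. - lookup a v - 1)"
      unfolding of_nat_sum using neg by (intro sum.cong refl) (simp add: Suc_leI)
    also have "\<dots> = - total_degree a - int (n + 1)"
      by (simp add: sum_subtractf sum_negf total_degree_def card)
    finally have "j \<le> (\<Sum>v\<in>UNIV. nat (- lookup a v - 1))"
      using total_degree[OF a] by linarith
    \<comment> \<open>Multiplication by \<open>x\<^sup>m\<close> of degree \<open>j\<close> keeps all exponents of the monomial \<open>x\<^sup>a\<close> negative.\<close>
    then obtain m where m: "\<And>v. lookup m v \<le> nat (- lookup a v - 1)" "(\<Sum>v\<in>UNIV. lookup m v) = j"
      by (rule exists_exponent_below) blast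
    have "int_exp m + a \<in> keys (laurent (single m 1) * g)"
      using a by (simp add: in_keys_iff laurent_single lookup_single_times)
    then obtain v where "0 \<le> lookup (int_exp m + a) v"
      using mono[OF m(2)] unfolding cech_image_def by blast
    then show False using m(1)[of v] neg[of v] by (simp add: lookup_add)
  qed
qed

section \<open>The hypersurface ring and its localizations\<close>

lemma residue_ring_hom:
  fixes f :: "('v::{finite,linorder}, 'k::field) mpoly"
  shows "ring_hom_cring mpoly_ring (hypersurface_ring f) (residue f)"
proof -
  interpret R: cring "mpoly_ring :: ('v, 'k) mpoly ring" ..
  interpret I: ideal "PIdl\<^bsub>mpoly_ring\<^esub> f" "mpoly_ring :: ('v, 'k) mpoly ring"
    by (rule R.cgenideal_ideal) simp
  have "residue f = (+>\<^bsub>mpoly_ring\<^esub>) (PIdl\<^bsub>mpoly_ring\<^esub> f)"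
    by (simp add: residue_def fun_eq_iff)
  then show ?thesis
    unfolding hypersurface_ring_def using I.rcos_ring_hom_cring[OF R.is_cring] by simp
qed

lemma residue_eq_iff:
  fixes f :: "('v::{finite,linorder}, 'k::field) mpoly"
  shows "residue f g = residue f h \<longleftrightarrow> f dvd g - h"
proof -
  have coset: "residue f g = {r * f + g |r. True}" for g
    by (auto simp: residue_def a_r_coset_def r_coset_def cgenideal_def)
  show ?thesis
  proof
    assume "residue f g = residue f h"
    moreover have "0 * f + g \<in> residue f g" unfolding coset by blast
    ultimately obtain r where "g = r * f + h" unfolding coset by auto
    then show "f dvd g - h" by simp
  next
    assume "f dvd g - h"
    then obtain s where s: "g = s * f + h" by (metis dvdE add.commute diff_add_cancel mult.commute)
    have "r * f + g = (r + s) * f + h" "r * f + h = (r - s) * f + g" for r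
      by (simp_all add: s algebra_simps)
    then show "residue f g = residue f h" unfolding coset by blast
  qed
qed

definition hvar :: "('v::finite, 'k::field) mpoly \<Rightarrow> 'v \<Rightarrow> ('v, 'k) mpoly set"
  where "hvar f = residue f \<circ> mpoly_var"

lemma hvar_apply: "hvar f v = residue f (mpoly_var v)"
  by (simp add: hvar_def)

context
  fixes f :: "('v::{finite,linorder}, 'k::field) mpoly"
begin

interpretation h: ring_hom_cring mpoly_ring "hypersurface_ring f" "residue f"
  by (rule residue_ring_hom)

lemma carrier_hypersurface_ring: "carrier (hypersurface_ring f) = range (residue f)"
  unfolding hypersurface_ring_def FactRing_simps residue_def by auto

lemma residue_closed [simp]: "residue f g \<in> carrier (hypersurface_ring f)"
  by (simp add: carrier_hypersurface_ring)

lemma residue_mult: "residue f g \<otimes>\<^bsub>hypersurface_ring f\<^esub> residue f h = residue f (g * h)"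
  using h.hom_mult[of g h] by simp

lemma residue_add: "residue f g \<oplus>\<^bsub>hypersurface_ring f\<^esub> residue f h = residue f (g + h)"
  using h.hom_add[of g h] by simp

lemma residue_minus: "residue f g \<ominus>\<^bsub>hypersurface_ring f\<^esub> residue f h = residue f (g - h)"
  using h.hom_a_inv[of h] h.hom_add[of g "- h"] by (simp add: a_minus_def)

lemma residue_one: "\<one>\<^bsub>hypersurface_ring f\<^esub> = residue f 1"
  using h.hom_one by simp

lemma residue_zero: "\<zero>\<^bsub>hypersurface_ring f\<^esub> = residue f 0"
  using h.hom_zero by simp

lemma residue_power: "residue f g [^]\<^bsub>hypersurface_ring f\<^esub> (n :: nat) = residue f (g ^ n)"
  by (induction n) (simp_all add: residue_one residue_mult mult.commute)

lemma mpoly_var_power: "(mpoly_var v :: ('v, 'k) mpoly) ^ n = single (single v n) 1"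
  by (induction n) (simp_all add: mpoly_var_def mult_single single_add[symmetric])

lemma residue_monomial:
  "finite J \<Longrightarrow> (\<Otimes>\<^bsub>hypersurface_ring f\<^esub>i\<in>J. (hvar f) i [^]\<^bsub>hypersurface_ring f\<^esub> (e i :: nat))
    = residue f (single (\<Sum>i\<in>J. single i (e i)) 1)"
  by (induction J rule: finite_induct)
     (simp_all add: hvar_apply residue_one residue_power residue_mult mpoly_var_power mult_single Pi_def)

text \<open>
  The denominators are indexed by exponent vectors rather than by their values in \<open>R/fR\<close>, where different monomials may coincide.
\<close>

lemma denominators_eq:
  "denominators (hypersurface_ring f) (hvar f) J = {residue f (single m 1) |m. keys m \<subseteq> J}"
proof (intro equalityI subsetI)
  fix s assume "s \<in> denominators (hypersurface_ring f) (hvar f) J"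
  then obtain e :: "'v \<Rightarrow> nat" where "s = residue f (single (\<Sum>i\<in>J. single i (e i)) 1)"
    unfolding denominators_def by (auto simp: residue_monomial)
  moreover have "keys (\<Sum>i\<in>J. single i (e i)) \<subseteq> J"
    by (auto simp: in_keys_iff lookup_sum lookup_single when_def split: if_splits)
  ultimately show "s \<in> {residue f (single m 1) |m. keys m \<subseteq> J}" by blast
next
  fix s assume "s \<in> {residue f (single m 1) |m. keys m \<subseteq> J}"
  then obtain m where m: "s = residue f (single m 1)" "keys m \<subseteq> J" by blast
  have "(\<Sum>i\<in>J. single i (lookup m i)) = m"
    using m(2) by (intro poly_mapping_eqI)
      (auto simp: lookup_sum lookup_single when_def sum.delta in_keys_iff)
  then have "s = (\<Otimes>\<^bsub>hypersurface_ring f\<^esub>i\<in>J. (hvar f) i [^]\<^bsub>hypersurface_ring f\<^esub> lookup m i)"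
    by (simp only: residue_monomial[OF finite] m(1))
  then show "s \<in> denominators (hypersurface_ring f) (hvar f) J"
    unfolding denominators_def by blast
qed

end

definition multiples :: "('v, 'k::comm_ring_1) mpoly \<Rightarrow> 'v set \<Rightarrow> ('v, 'k) laurent set"
  where "multiples f J = (\<lambda>h. laurent f * h) ` loc J"

lemma multiples_zero [simp]: "0 \<in> multiples f J"
  unfolding multiples_def by (rule image_eqI[of _ _ 0]) simp_all

lemma multiples_add: "g \<in> multiples f J \<Longrightarrow> h \<in> multiples f J \<Longrightarrow> g + h \<in> multiples f J"
  unfolding multiples_def by (auto simp flip: distrib_left intro!: imageI loc_add)

lemma multiples_uminus [simp]:
  fixes g :: "('v, 'k::comm_ring_1) laurent"
  shows "- g \<in> multiples f J \<longleftrightarrow> g \<in> multiples f J"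
proof -
  have "- g \<in> multiples f J" if g: "g \<in> multiples f J" for g :: "('v, 'k) laurent"
  proof -
    obtain h where "h \<in> loc J" "g = laurent f * h" using g unfolding multiples_def by blast
    then show ?thesis unfolding multiples_def by (intro image_eqI[of _ _ "- h"]) simp_all
  qed
  from this[of g] this[of "- g"] show ?thesis by auto
qed

lemma multiples_diff: "g \<in> multiples f J \<Longrightarrow> h \<in> multiples f J \<Longrightarrow> g - h \<in> multiples f J"
  using multiples_add[of g f J "- h"] by simp

lemma multiples_minus_commute: "g - h \<in> multiples f J \<longleftrightarrow> h - g \<in> multiples f J"
  using multiples_uminus[of "g - h" f J] by simp

lemma multiples_mult:
  assumes "g \<in> multiples f J" "h \<in> loc J" shows "h * g \<in> multiples f J"
proof -
  obtain k where "k \<in> loc J" "g = laurent f * k" using assms(1) unfolding multiples_def by blast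
  then show ?thesis
    unfolding multiples_def using assms(2)
    by (intro image_eqI[of _ _ "h * k"]) (simp_all add: loc_mult mult.left_commute)
qed

lemma multiples_mono: "J \<subseteq> K \<Longrightarrow> multiples f J \<subseteq> multiples f K"
  unfolding multiples_def using loc_mono by blast

lemma multiples_subset_loc: "multiples f J \<subseteq> loc J"
  unfolding multiples_def by (auto intro: loc_mult)

abbreviation inv_monomial :: "('v \<Rightarrow>\<^sub>0 nat) \<Rightarrow> ('v, 'k::comm_ring_1) laurent"
  where "inv_monomial m \<equiv> single (- int_exp m) 1"

lemma monomial_inverse: "laurent (single m 1) * inv_monomial m = (1 :: ('v, 'k::comm_ring_1) laurent)"
  by (simp add: laurent_single mult_single)

text \<open>
  All pairs (numerator, denominator) that represent the class of \<open>g\<close> modulo \<open>f\<close>. In this form it is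
  independent of a choice of numerator and denominator for \<open>g\<close>, so operations given on representatives of fractions
  need not be shown to be well defined one by one.
\<close>

definition lclass :: "('v::finite, 'k::field) mpoly \<Rightarrow> 'v set \<Rightarrow> ('v, 'k) laurent \<Rightarrow> (('v, 'k) mpoly set \<times> ('v, 'k) mpoly set) set"
  where "lclass f J g = {(residue f b, residue f (single m 1)) |b m.
    keys m \<subseteq> J \<and> g - laurent b * inv_monomial m \<in> multiples f J}"

lemma lclassI:
  "keys m \<subseteq> J \<Longrightarrow> g - laurent b * inv_monomial m \<in> multiples f J \<Longrightarrow>
    (residue f b, residue f (single m 1)) \<in> lclass f J g"
  unfolding lclass_def by (intro CollectI exI[of _ b] exI[of _ m]) simp

lemma lclassE:
  assumes "(a, s) \<in> lclass f J g"
  obtains b m where "a = residue f b" "s = residue f (single m 1)" "keys m \<subseteq> J"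
    "g - laurent b * inv_monomial m \<in> multiples f J"
  using assms unfolding lclass_def mem_Collect_eq prod.inject by blast

lemma loc_as_fraction:
  fixes g :: "('v::{finite,linorder}, 'k::field) laurent"
  assumes "g \<in> loc J"
  obtains b m where "keys m \<subseteq> J" "g = laurent b * inv_monomial m"
proof -
  obtain r m where "keys m \<subseteq> J" "g * single (int_exp m) 1 = laurent r"
    using clear_denominators[OF assms] by blast
  then have "g * (single (int_exp m) 1 * inv_monomial m) = laurent r * inv_monomial m"
    by (simp flip: mult.assoc)
  then have "g = laurent r * inv_monomial m" by (simp add: mult_single)
  with \<open>keys m \<subseteq> J\<close> show ?thesis by (rule that)
qed

lemma fraction_in_loc: "keys m \<subseteq> J \<Longrightarrow> laurent b * inv_monomial m \<in> loc J"
  by (intro loc_mult loc_single) simp_all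

text \<open>
  Monomials are units among the Laurent polynomials, so the auxiliary factor in the definition of equal
  fractions can be divided out; conversely, it clears the denominators of the cofactor of \<open>f\<close>.
\<close>

lemma cross_multiplication:
  fixes f :: "('v::{finite,linorder}, 'k::field) mpoly"
  assumes m: "keys m \<subseteq> J" "keys m' \<subseteq> J"
  shows "(\<exists>c. keys c \<subseteq> J \<and> f dvd single c 1 * (a * single m' 1 - b * single m 1)) \<longleftrightarrow>
    laurent a * inv_monomial m - laurent b * inv_monomial m' \<in> multiples f J" (is "?L \<longleftrightarrow> ?R")
proof -
  define x where "x n = laurent (single n 1 :: ('v, 'k) mpoly)" for n
  define y where "y n = (inv_monomial n :: ('v, 'k) laurent)" for n
  have xy: "x n * y n = 1" for n unfolding x_def y_def by (rule monomial_inverse)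
  have yx: "y n * x n = 1" for n using xy[of n] by (simp add: mult.commute)
  have y: "y n \<in> loc J" if "keys n \<subseteq> J" for n using that unfolding y_def by (rule loc_single)
  define D where "D = laurent a * y m - laurent b * y m'"
  have D: "laurent (a * single m' 1 - b * single m 1) = (x m * x m') * D"
  proof -
    have "(x m * x m') * D = laurent a * x m' * (x m * y m) - laurent b * x m * (x m' * y m')"
      unfolding D_def by (simp add: algebra_simps)
    then show ?thesis unfolding laurent_diff laurent_mult x_def[symmetric] by (simp add: xy)
  qed
  have inv: "(y m * y m') * ((x m * x m') * D) = D"
  proof -
    have "(y m * y m') * ((x m * x m') * D) = (x m * y m) * (x m' * y m') * D" by (simp only: ac_simps)
    then show ?thesis by (simp add: xy)
  qed
  show ?thesis
    unfolding D_def[unfolded y_def, symmetric]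
  proof
    assume ?L
    then obtain c where "keys c \<subseteq> J" "f dvd single c 1 * (a * single m' 1 - b * single m 1)"
      by blast
    then obtain r where c: "keys c \<subseteq> J" "single c 1 * (a * single m' 1 - b * single m 1) = f * r"
      unfolding dvd_def by blast
    have "x c * ((x m * x m') * D) = laurent f * laurent r"
      using arg_cong[OF c(2), of laurent] unfolding laurent_mult D x_def[symmetric] .
    then have "(y m * y m') * (y c * (x c * ((x m * x m') * D))) = (y m * y m' * y c) * (laurent f * laurent r)"
      by (simp add: mult.assoc)
    moreover have "(y m * y m') * (y c * (x c * ((x m * x m') * D))) = D"
      using inv by (simp add: yx flip: mult.assoc[of "y c" "x c"])
    ultimately have "D = (y m * y m' * y c) * (laurent f * laurent r)" by simp
    moreover have "laurent f * laurent r \<in> multiples f J" unfolding multiples_def by (rule imageI) simp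
    ultimately show "D \<in> multiples f J"
      using y m c(1) by (simp add: multiples_mult loc_mult)
  next
    assume "D \<in> multiples f J"
    then obtain h where h: "h \<in> loc J" "D = laurent f * h" unfolding multiples_def by blast
    obtain r c where c: "keys c \<subseteq> J" "h * single (int_exp c) 1 = laurent r"
      using clear_denominators[OF h(1)] by blast
    have "laurent (single c 1 * (a * single m' 1 - b * single m 1))
        = laurent f * (x m * x m') * (h * single (int_exp c) 1)"
      unfolding laurent_mult D h(2) by (simp add: laurent_single ac_simps)
    also have "\<dots> = laurent (f * (single m 1 * single m' 1 * r))"
      unfolding c(2) x_def by (simp only: laurent_mult ac_simps)
    finally have "f dvd single c 1 * (a * single m' 1 - b * single m 1)"
      unfolding laurent_eq_iff by (metis dvd_triv_left)
    then show ?L using c(1) by blast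
  qed
qed

lemma Collect_pairs_image_eq:
  assumes "\<And>b m. K m \<Longrightarrow> C (r b) (s m) \<longleftrightarrow> R b m"
  shows "{(x, t). x \<in> range r \<and> t \<in> {s m |m. K m} \<and> C x t} = {(r b, s m) |b m. K m \<and> R b m}"
  using assms by auto

lemma fraction_eq_lclass:
  fixes f :: "('v::{finite,linorder}, 'k::field) mpoly"
  assumes m: "keys m \<subseteq> J"
  shows "fraction (hypersurface_ring f) (denominators (hypersurface_ring f) (hvar f) J)
      (residue f a) (residue f (single m 1)) = lclass f J (laurent a * inv_monomial m)"
proof -
  have key: "(\<exists>u \<in> {residue f (single c 1) |c. keys c \<subseteq> J}.
      u \<otimes>\<^bsub>hypersurface_ring f\<^esub> (residue f a \<otimes>\<^bsub>hypersurface_ring f\<^esub> residue f (single m' 1)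
        \<ominus>\<^bsub>hypersurface_ring f\<^esub> residue f b \<otimes>\<^bsub>hypersurface_ring f\<^esub> residue f (single m 1)) = \<zero>\<^bsub>hypersurface_ring f\<^esub>)
    \<longleftrightarrow> laurent a * inv_monomial m - laurent b * inv_monomial m' \<in> multiples f J"
    if "keys m' \<subseteq> J" for b m'
  proof -
    have "(\<exists>u \<in> {residue f (single c 1) |c. keys c \<subseteq> J}. u \<otimes>\<^bsub>hypersurface_ring f\<^esub> z = \<zero>\<^bsub>hypersurface_ring f\<^esub>)
      \<longleftrightarrow> (\<exists>c. keys c \<subseteq> J \<and> residue f (single c 1) \<otimes>\<^bsub>hypersurface_ring f\<^esub> z = \<zero>\<^bsub>hypersurface_ring f\<^esub>)" for z
      by blast
    then show ?thesis
      unfolding cross_multiplication[OF m that, symmetric]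
      by (simp add: residue_mult residue_minus residue_zero residue_eq_iff)
  qed
  show ?thesis
    unfolding fraction_def denominators_eq lclass_def carrier_hypersurface_ring
    by (rule Collect_pairs_image_eq) (rule key)
qed

lemma lclass_eq_iff:
  fixes f :: "('v::{finite,linorder}, 'k::field) mpoly"
  assumes "g \<in> loc J" "h \<in> loc J"
  shows "lclass f J g = lclass f J h \<longleftrightarrow> g - h \<in> multiples f J"
proof
  assume eq: "lclass f J g = lclass f J h"
  obtain b m where m: "keys m \<subseteq> J" "h = laurent b * inv_monomial m"
    using loc_as_fraction[OF assms(2)] by blast
  have "(residue f b, residue f (single m 1)) \<in> lclass f J h"
    by (rule lclassI[OF m(1)]) (simp add: m(2))
  then obtain b' m' where bm': "residue f b = residue f b'" "residue f (single m 1) = residue f (single m' 1)"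
    "keys m' \<subseteq> J" "g - laurent b' * inv_monomial m' \<in> multiples f J"
    unfolding eq[symmetric] by (rule lclassE) simp
  show "g - h \<in> multiples f J"
  proof -
    \<comment> \<open>\<open>b / m\<close> and \<open>b' / m'\<close> have the same numerator and denominator modulo \<open>f\<close>\<close>
    have "f dvd b - b'" "f dvd single m 1 - single m' 1"
      using bm'(1,2) by (simp_all add: residue_eq_iff)
    then have "f dvd b * single m' 1 - b' * single m 1"
    proof -
      have "b * single m' 1 - b' * single m 1 = (b - b') * single m' 1 - b' * (single m 1 - single m' 1)"
        by (simp add: algebra_simps)
      then show ?thesis using \<open>f dvd b - b'\<close> \<open>f dvd single m 1 - single m' 1\<close> by (simp add: dvd_diff)
    qed
    then have "f dvd single 0 1 * (b * single m' 1 - b' * single m 1)" by simp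
    then have "h - laurent b' * inv_monomial m' \<in> multiples f J"
      unfolding m(2) cross_multiplication[OF m(1) bm'(3), symmetric] by (intro exI[of _ 0]) simp
    from multiples_diff[OF bm'(4) this] show ?thesis by simp
  qed
next
  assume gh: "g - h \<in> multiples f J"
  have "g - z \<in> multiples f J \<longleftrightarrow> h - z \<in> multiples f J" for z
    using multiples_add[of "h - z" f J "g - h"] multiples_diff[of "g - z" f J "g - h"] gh by auto
  then show "lclass f J g = lclass f J h" unfolding lclass_def by simp
qed

text \<open>
  The operations on localizations are unions over all representatives. When the united sets agree, the union
  is their common value, as there is at least one representative.
\<close>

lemma UN_lclass:
  fixes f :: "('v::{finite,linorder}, 'k::field) mpoly"
  assumes g: "g \<in> loc J"
    and Q: "\<And>b m. keys m \<subseteq> J \<Longrightarrow> g - laurent b * inv_monomial m \<in> multiples f J \<Longrightarrow>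
      Q (residue f b) (residue f (single m 1)) = V"
  shows "(\<Union>(a, s)\<in>lclass f J g. Q a s) = V"
proof -
  obtain b m where "keys m \<subseteq> J" "g = laurent b * inv_monomial m"
    using loc_as_fraction[OF g] by blast
  then have "(residue f b, residue f (single m 1)) \<in> lclass f J g"
    by (intro lclassI) simp_all
  moreover have "Q a s = V" if "(a, s) \<in> lclass f J g" for a s
    using that by (rule lclassE) (simp add: Q)
  ultimately show ?thesis by (intro equalityI subsetI) auto
qed

abbreviation hloc :: "('v::finite, 'k::field) mpoly \<Rightarrow> 'v set \<Rightarrow> (('v, 'k) mpoly set \<times> ('v, 'k) mpoly set) set ring"
  where "hloc f J \<equiv> cech_localization (hypersurface_ring f) (hvar f) J"

lemma carrier_hloc:
  fixes f :: "('v::{finite,linorder}, 'k::field) mpoly"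
  shows "carrier (hloc f J) = lclass f J ` loc J"
proof (intro equalityI subsetI)
  fix U assume "U \<in> carrier (hloc f J)"
  then obtain a m where "keys m \<subseteq> J" "U = fraction (hypersurface_ring f)
      (denominators (hypersurface_ring f) (hvar f) J) (residue f a) (residue f (single m 1))"
    unfolding localization_def by (auto simp: denominators_eq carrier_hypersurface_ring)
  then show "U \<in> lclass f J ` loc J"
    using fraction_eq_lclass fraction_in_loc by blast
next
  fix U assume "U \<in> lclass f J ` loc J"
  then obtain g where g: "g \<in> loc J" "U = lclass f J g" by blast
  obtain b m where m: "keys m \<subseteq> J" "g = laurent b * inv_monomial m"
    using loc_as_fraction[OF g(1)] by blast
  then have "U = fraction (hypersurface_ring f)
      (denominators (hypersurface_ring f) (hvar f) J) (residue f b) (residue f (single m 1))"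
    using fraction_eq_lclass g by metis
  moreover have "residue f (single m 1) \<in> denominators (hypersurface_ring f) (hvar f) J"
    unfolding denominators_eq using m(1) by blast
  ultimately have "\<exists>a s. U = fraction (hypersurface_ring f) (denominators (hypersurface_ring f) (hvar f) J) a s \<and>
      a \<in> carrier (hypersurface_ring f) \<and> s \<in> denominators (hypersurface_ring f) (hvar f) J"
    by (intro exI[of _ "residue f b"] exI[of _ "residue f (single m 1)"] conjI residue_closed)
  then show "U \<in> carrier (hloc f J)"
    by (simp add: localization_def)
qed

lemma inv_monomial_add: "inv_monomial (m + m') = inv_monomial m * inv_monomial m'"
  by (simp add: mult_single int_exp_add)

lemma keys_add_subset:
  fixes m m' :: "'v \<Rightarrow>\<^sub>0 nat"
  shows "keys m \<subseteq> J \<Longrightarrow> keys m' \<subseteq> J \<Longrightarrow> keys (m + m') \<subseteq> J"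
  using Poly_Mapping.keys_add[of m m'] by (meson order_trans Un_least)

lemma hloc_add:
  fixes f :: "('v::{finite,linorder}, 'k::field) mpoly"
  assumes g: "g \<in> loc J" and h: "h \<in> loc J"
  shows "lclass f J g \<oplus>\<^bsub>hloc f J\<^esub> lclass f J h = lclass f J (g + h)"
proof -
  let ?S = "denominators (hypersurface_ring f) (hvar f) J"
  have sum: "fraction (hypersurface_ring f) ?S
      (residue f a \<otimes>\<^bsub>hypersurface_ring f\<^esub> residue f (single m' 1) \<oplus>\<^bsub>hypersurface_ring f\<^esub>
        residue f b \<otimes>\<^bsub>hypersurface_ring f\<^esub> residue f (single m 1))
      (residue f (single m 1) \<otimes>\<^bsub>hypersurface_ring f\<^esub> residue f (single m' 1)) = lclass f J (g + h)"
    if m: "keys m \<subseteq> J" "g - laurent a * inv_monomial m \<in> multiples f J"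
      and m': "keys m' \<subseteq> J" "h - laurent b * inv_monomial m' \<in> multiples f J" for a b m m'
  proof -
    have "fraction (hypersurface_ring f) ?S
      (residue f (a * single m' 1 + b * single m 1)) (residue f (single (m + m') 1))
      = lclass f J (laurent (a * single m' 1 + b * single m 1) * inv_monomial (m + m'))"
      using m m' by (intro fraction_eq_lclass keys_add_subset)
    also have "laurent (a * single m' 1 + b * single m 1) * inv_monomial (m + m')
      = laurent a * inv_monomial m + laurent b * inv_monomial m'"
    proof -
      have "laurent (a * single m' 1 + b * single m 1) * inv_monomial (m + m')
        = laurent a * inv_monomial m * (laurent (single m' 1) * inv_monomial m')
          + laurent b * inv_monomial m' * (laurent (single m 1) * inv_monomial m)"
        unfolding inv_monomial_add laurent_add laurent_mult by (simp only: algebra_simps)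
      then show ?thesis by (simp only: monomial_inverse mult_1_right)
    qed
    also have "lclass f J \<dots> = lclass f J (g + h)"
    proof (subst lclass_eq_iff)
      show "laurent a * inv_monomial m + laurent b * inv_monomial m' \<in> loc J"
        using m m' by (intro loc_add fraction_in_loc)
      show "g + h \<in> loc J" using g h by (rule loc_add)
      have "g + h - (laurent a * inv_monomial m + laurent b * inv_monomial m') \<in> multiples f J"
        using multiples_add[OF m(2) m'(2)] by (simp add: algebra_simps)
      then show "laurent a * inv_monomial m + laurent b * inv_monomial m' - (g + h) \<in> multiples f J"
        by (simp only: multiples_minus_commute)
    qed
    finally show ?thesis by (simp add: residue_mult residue_add mult_single)
  qed
  show ?thesis
    unfolding localization_def ring_record_simps
    by (intro UN_lclass[OF g] UN_lclass[OF h] sum)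
qed

lemma hloc_zero:
  fixes f :: "('v::{finite,linorder}, 'k::field) mpoly"
  shows "\<zero>\<^bsub>hloc f J\<^esub> = lclass f J 0"
  using fraction_eq_lclass[of 0 J f 0] by (simp add: localization_def residue_zero residue_one)

lemma hloc_abelian_group:
  fixes f :: "('v::{finite,linorder}, 'k::field) mpoly"
  shows "abelian_group (hloc f J)"
proof (rule abelian_groupI)
  show "\<exists>y\<in>carrier (hloc f J). y \<oplus>\<^bsub>hloc f J\<^esub> x = \<zero>\<^bsub>hloc f J\<^esub>" if x: "x \<in> carrier (hloc f J)" for x
  proof -
    obtain g where g: "g \<in> loc J" "x = lclass f J g" using x by (auto simp: carrier_hloc)
    then show ?thesis
      by (intro bexI[of _ "lclass f J (- g)"]) (simp_all add: hloc_add hloc_zero carrier_hloc)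
  qed
qed (auto simp: carrier_hloc hloc_add hloc_zero loc_add add_ac)

lemma hloc_a_inv:
  fixes f :: "('v::{finite,linorder}, 'k::field) mpoly"
  assumes "g \<in> loc J"
  shows "\<ominus>\<^bsub>hloc f J\<^esub> lclass f J g = lclass f J (- g)"
proof -
  interpret G: abelian_group "hloc f J" by (rule hloc_abelian_group)
  show ?thesis
    by (rule G.minus_equality) (use assms in \<open>simp_all add: carrier_hloc hloc_add hloc_zero\<close>)
qed

lemma hloc_finsum:
  fixes f :: "('v::{finite,linorder}, 'k::field) mpoly"
  assumes "finite I" "\<And>i. i \<in> I \<Longrightarrow> g i \<in> loc J"
  shows "(\<Oplus>\<^bsub>hloc f J\<^esub>i\<in>I. lclass f J (g i)) = lclass f J (\<Sum>i\<in>I. g i)"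
proof -
  interpret G: abelian_group "hloc f J" by (rule hloc_abelian_group)
  show ?thesis
    using assms
  proof (induction I rule: finite_induct)
    case (insert i I)
    then have "(\<lambda>i. lclass f J (g i)) \<in> I \<rightarrow> carrier (hloc f J)" "lclass f J (g i) \<in> carrier (hloc f J)"
      by (auto simp: carrier_hloc)
    with insert show ?case by (simp add: hloc_add loc_sum)
  qed (simp add: hloc_zero)
qed

lemma localization_map_inclusion:
  fixes f :: "('v::{finite,linorder}, 'k::field) mpoly"
  assumes "J \<subseteq> K" "g \<in> loc J"
  shows "localization_map (hypersurface_ring f) (denominators (hypersurface_ring f) (hvar f) K) (\<lambda>a. a) (lclass f J g)
    = lclass f K g"
  unfolding localization_map_def
proof (rule UN_lclass[OF assms(2)])
  fix b and m :: "'v \<Rightarrow>\<^sub>0 nat" assume m: "keys m \<subseteq> J" "g - laurent b * inv_monomial m \<in> multiples f J"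
  have K: "keys m \<subseteq> K" using m(1) assms(1) by blast
  have "g \<in> loc K" "g - laurent b * inv_monomial m \<in> multiples f K"
    using assms loc_mono multiples_mono m(2) by blast+
  then show "fraction (hypersurface_ring f) (denominators (hypersurface_ring f) (hvar f) K) (residue f b) (residue f (single m 1))
    = lclass f K g"
    unfolding fraction_eq_lclass[OF K] using fraction_in_loc[OF K]
    by (subst lclass_eq_iff) (simp_all add: multiples_minus_commute)
qed

text \<open>
  \<open>g\<^sup>p - h\<^sup>p = (g - h)\<^sup>p\<close> in characteristic \<open>p\<close>.
\<close>

lemma multiples_power_diff:
  fixes f :: "('v::{finite,linorder}, 'k::field) mpoly"
  assumes p: "Factorial_Ring.prime p" "p = CHAR('k)" and gh: "g - h \<in> multiples f J"
  shows "g ^ p - h ^ p \<in> multiples f J"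
proof -
  have "((g - h) + h) ^ p = (g - h) ^ p + h ^ p"
    using p by (intro freshmans_dream) simp_all
  then have eq: "g ^ p - h ^ p = (g - h) ^ p" by simp
  have "(g - h) ^ Suc n \<in> multiples f J" for n
    using gh multiples_subset_loc[of f J] by (induction n) (auto intro: multiples_mult)
  moreover obtain n where "p = Suc n" using prime_gt_0_nat[OF p(1)] by (cases p) auto
  ultimately show ?thesis unfolding eq by simp
qed

lemma localization_map_frobenius:
  fixes f :: "('v::{finite,linorder}, 'k::field) mpoly"
  assumes p: "Factorial_Ring.prime p" "p = CHAR('k)" and g: "g \<in> loc J"
  shows "localization_map (hypersurface_ring f) (denominators (hypersurface_ring f) (hvar f) J)
      (\<lambda>a. a [^]\<^bsub>hypersurface_ring f\<^esub> p) (lclass f J g) = lclass f J (g ^ p)"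
  unfolding localization_map_def
proof (rule UN_lclass[OF g])
  fix b and m :: "'v \<Rightarrow>\<^sub>0 nat" assume m: "keys m \<subseteq> J" "g - laurent b * inv_monomial m \<in> multiples f J"
  have pow: "single m (1::'k) ^ p = single (Poly_Mapping.map ((*) p) m) 1"
  proof (rule laurent_eq_iff[THEN iffD1])
    have "scale_exp p (int_exp m) = int_exp (Poly_Mapping.map ((*) p) m)"
      by (rule poly_mapping_eqI) (simp add: Poly_Mapping.map.rep_eq when_def)
    then show "laurent (single m (1::'k) ^ p) = laurent (single (Poly_Mapping.map ((*) p) m) 1)"
      by (simp add: laurent_power laurent_single power_single)
  qed
  have inv: "(inv_monomial m :: ('v, 'k) laurent) ^ p = inv_monomial (Poly_Mapping.map ((*) p) m)"
  proof -
    have "scale_exp p (- int_exp m) = - int_exp (Poly_Mapping.map ((*) p) m)"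
      by (rule poly_mapping_eqI) (simp add: Poly_Mapping.map.rep_eq when_def)
    then show ?thesis by (simp add: power_single)
  qed
  have K: "keys (Poly_Mapping.map ((*) p) m) \<subseteq> J"
    using m(1) by (auto simp: in_keys_iff Poly_Mapping.map.rep_eq when_def split: if_splits)
  have "g ^ p - laurent (b ^ p) * inv_monomial (Poly_Mapping.map ((*) p) m) \<in> multiples f J"
    using multiples_power_diff[OF p m(2)] by (simp add: power_mult_distrib laurent_power inv)
  then show "fraction (hypersurface_ring f) (denominators (hypersurface_ring f) (hvar f) J)
      (residue f b [^]\<^bsub>hypersurface_ring f\<^esub> p) (residue f (single m 1) [^]\<^bsub>hypersurface_ring f\<^esub> p) = lclass f J (g ^ p)"
    unfolding residue_power pow fraction_eq_lclass[OF K] using fraction_in_loc[OF K] loc_power[OF g]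
    by (subst lclass_eq_iff) (simp_all add: multiples_minus_commute)
qed

text \<open>
  Multiplication by a homogeneous polynomial shifts degrees, so it commutes with the selection of a set of degrees.
\<close>

lemma project_homogeneous_mult:
  fixes f :: "('v::{finite,linorder}, 'k::field) mpoly"
  assumes f: "f \<in> homogeneous_polys d"
  shows "project (\<lambda>a. Q (total_degree a)) (laurent f * g) = laurent f * project (\<lambda>a. Q (total_degree a + d)) g"
proof -
  define g1 g2 where "g1 = project (\<lambda>a. Q (total_degree a + d)) g" and "g2 = project (\<lambda>a. \<not> Q (total_degree a + d)) g"
  have g: "g = g1 + g2" unfolding g1_def g2_def by (rule project_add_complement[symmetric])
  have keys: "\<exists>b\<in>keys h. total_degree a = total_degree b + d" if a: "a \<in> keys (laurent f * h)" for a h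
  proof -
    obtain c b where "a = c + b" "c \<in> keys (laurent f)" "b \<in> keys h"
      using subsetD[OF keys_mult a] by blast
    then show ?thesis using f by (auto simp: homogeneous_polys_iff)
  qed
  have Q1: "Q (total_degree a)" if "a \<in> keys (laurent f * g1)" for a
    using keys[OF that] by (auto simp: g1_def keys_project)
  have Q2: "\<not> Q (total_degree a)" if "a \<in> keys (laurent f * g2)" for a
    using keys[OF that] by (auto simp: g2_def keys_project)
  have 1: "project (\<lambda>a. Q (total_degree a)) (laurent f * g1) = laurent f * g1"
  proof (rule poly_mapping_eqI)
    fix a show "lookup (project (\<lambda>a. Q (total_degree a)) (laurent f * g1)) a = lookup (laurent f * g1) a"
      using Q1[of a] by (cases "a \<in> keys (laurent f * g1)") (simp_all add: lookup_project in_keys_iff when_def)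
  qed
  have 2: "project (\<lambda>a. Q (total_degree a)) (laurent f * g2) = 0"
  proof (rule poly_mapping_eqI)
    fix a show "lookup (project (\<lambda>a. Q (total_degree a)) (laurent f * g2)) a = lookup 0 a"
      using Q2[of a] by (cases "a \<in> keys (laurent f * g2)") (simp_all add: lookup_project in_keys_iff when_def)
  qed
  show ?thesis
    unfolding g1_def[symmetric] by (subst g) (simp add: distrib_left project_add 1 2)
qed

definition loc_piece :: "'v::finite set \<Rightarrow> int \<Rightarrow> ('v, 'k::comm_ring_1) laurent set"
  where "loc_piece J i = {g \<in> loc J. \<forall>a\<in>keys g. total_degree a = i}"

lemma total_degree_int_exp: "total_degree (int_exp m) = int (\<Sum>v\<in>UNIV. lookup m v)"
  by (simp add: total_degree_def)

text \<open>
  A fraction may have a denominator \<open>x\<^sup>m\<close> that is congruent modulo \<open>f\<close> to an element of a degree \<open>e\<close> other than its own.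
  Then \<open>x\<^sup>m\<close> is the component of its degree in a multiple of \<open>f\<close>, hence itself a multiple of \<open>f\<close>, and the localization is zero.
\<close>

lemma localization_piece_eq:
  fixes f :: "('v::{finite,linorder}, 'k::field) mpoly"
  assumes f: "f \<in> homogeneous_polys d"
  shows "localization_piece (hypersurface_ring f) (denominators (hypersurface_ring f) (hvar f) J) (residue_grading f) i
    = lclass f J ` loc_piece J i"
proof (intro equalityI subsetI)
  fix U assume "U \<in> localization_piece (hypersurface_ring f) (denominators (hypersurface_ring f) (hvar f) J) (residue_grading f) i"
  then obtain e a s m where m: "keys m \<subseteq> J" and s: "residue f (single m 1) = residue f s" "s \<in> homogeneous_polys e"
    and a: "a \<in> homogeneous_polys (i + e)"
    and U: "U = fraction (hypersurface_ring f) (denominators (hypersurface_ring f) (hvar f) J)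
      (residue f a) (residue f (single m 1))"
    unfolding localization_piece_def denominators_eq residue_grading_def by auto
  show "U \<in> lclass f J ` loc_piece J i"
  proof (cases "total_degree (int_exp m) = e")
    case True
    have "laurent a * inv_monomial m \<in> loc_piece J i"
      unfolding loc_piece_def
    proof (intro CollectI conjI ballI)
      show "laurent a * inv_monomial m \<in> loc J" using m by (rule fraction_in_loc)
      fix b assume "b \<in> keys (laurent a * inv_monomial m)"
      then obtain c where "c \<in> keys (laurent a)" "b = - int_exp m + c"
        using keys_single_times[of "- int_exp m" "laurent a"] by (auto simp: mult.commute)
      then show "total_degree b = i" using a True by (simp add: homogeneous_polys_iff)
    qed
    then show ?thesis unfolding U fraction_eq_lclass[OF m] by blast
  next
    case False
    obtain r where r: "single m 1 - s = f * r" using s(1) by (auto simp: residue_eq_iff elim!: dvdE)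
    define D where "D = total_degree (int_exp m)"
    have "laurent f * project (\<lambda>a. total_degree a + d = D) (laurent r) = project (\<lambda>a. total_degree a = D) (laurent (f * r))"
      unfolding laurent_mult using project_homogeneous_mult[OF f, of "\<lambda>x. x = D"] by simp
    also have "\<dots> = single (int_exp m) 1"
      unfolding r[symmetric]
    proof (rule poly_mapping_eqI)
      fix b
      have "lookup (laurent s) b = 0" if "total_degree b = D"
        using s(2) False that by (auto simp: homogeneous_polys_iff D_def in_keys_iff)
      then show "lookup (project (\<lambda>a. total_degree a = D) (laurent (single m 1 - s))) b = lookup (single (int_exp m) 1) b"
        by (auto simp: lookup_project laurent_diff laurent_single lookup_minus lookup_single when_def D_def)
    qed
    finally have "single (int_exp m) 1 \<in> multiples f J"
      unfolding multiples_def by (metis imageI loc_laurent loc_project)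
    then have "laurent a * inv_monomial m * inv_monomial m * single (int_exp m) 1 \<in> multiples f J"
      by (rule multiples_mult) (intro loc_mult loc_laurent loc_single m)
    moreover have "laurent a * inv_monomial m * inv_monomial m * single (int_exp m) 1 = laurent a * inv_monomial m"
      by (simp add: mult.assoc mult_single)
    ultimately have "U = lclass f J 0"
      unfolding U fraction_eq_lclass[OF m] using fraction_in_loc[OF m] by (subst lclass_eq_iff) simp_all
    moreover have "(0 :: ('v, 'k) laurent) \<in> loc_piece J i" by (simp add: loc_piece_def)
    ultimately show ?thesis by blast
  qed
next
  fix U assume "U \<in> lclass f J ` loc_piece J i"
  then obtain g where g: "g \<in> loc J" "\<And>a. a \<in> keys g \<Longrightarrow> total_degree a = i" "U = lclass f J g"
    unfolding loc_piece_def by blast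
  obtain b m where m: "keys m \<subseteq> J" "g = laurent b * inv_monomial m"
    using loc_as_fraction[OF g(1)] by blast
  define e where "e = total_degree (int_exp m)"
  have "laurent b = single (int_exp m) 1 * g"
    unfolding m(2) by (simp add: mult.left_commute mult_single)
  then have "b \<in> homogeneous_polys (i + e)"
    using g(2) keys_single_times[of "int_exp m" g] by (auto simp: homogeneous_polys_iff e_def)
  moreover have "single m (1::'k) \<in> homogeneous_polys e"
    by (simp add: homogeneous_polys_def e_def total_degree_int_exp)
  moreover have "U = fraction (hypersurface_ring f) (denominators (hypersurface_ring f) (hvar f) J)
      (residue f b) (residue f (single m 1))"
    unfolding fraction_eq_lclass[OF m(1)] g(3) m(2) ..
  ultimately show "U \<in> localization_piece (hypersurface_ring f) (denominators (hypersurface_ring f) (hvar f) J) (residue_grading f) i"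
    unfolding localization_piece_def denominators_eq residue_grading_def using m(1) by blast
qed

section \<open>The Cech complex of Laurent polynomials\<close>

definition face_sign :: "'v::linorder \<Rightarrow> 'v set \<Rightarrow> ('v, 'k::comm_ring_1) laurent"
  where "face_sign i K = (- 1) ^ card {l \<in> K. l < i}"

lemma face_sign_square [simp]: "face_sign i K * face_sign i K = 1"
  by (simp add: face_sign_def flip: power_add)

lemma face_sign_in_loc [simp]: "face_sign i K \<in> loc J"
  by (cases "even (card {l \<in> K. l < i})") (simp_all add: face_sign_def)

lemma project_sign: "project P (face_sign i K * g) = face_sign i K * project P g"
proof -
  have "project P (- g) = - project P g"
    using project_minus[of P 0 g] by simp
  then show ?thesis
    by (cases "even (card {l \<in> K. l < i})") (simp_all add: face_sign_def)
qed

lemma face_sign_Diff: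
  fixes i j :: "'v::{finite,linorder}"
  assumes "i \<in> K" "i \<noteq> j"
  shows "face_sign j (K - {i}) = (if i < j then - face_sign j K else face_sign j K)"
proof (cases "i < j")
  case True
  then have "{l \<in> K. l < j} = insert i {l \<in> K - {i}. l < j}" using assms(1) by auto
  then have "card {l \<in> K. l < j} = Suc (card {l \<in> K - {i}. l < j})" by simp
  with True show ?thesis by (simp add: face_sign_def)
next
  case False
  then have "{l \<in> K. l < j} = {l \<in> K - {i}. l < j}" by auto
  with False show ?thesis by (simp add: face_sign_def)
qed

text \<open>
  Removing the smaller of two elements changes the position of the larger one, but not conversely. This
  antisymmetry is used both for the square of the differential and for the contracting homotopy.
\<close>

lemma face_sign_swap:
  fixes i j :: "'v::{finite,linorder}"
  assumes "i \<in> K" "j \<in> K" "i \<noteq> j"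
  shows "face_sign j K * face_sign i (K - {j}) = - (face_sign i K * face_sign j (K - {i}))"
  using assms by (auto simp: face_sign_Diff mult.commute)

definition laurent_cochains :: "('v set \<Rightarrow> ('v, 'k::comm_ring_1) laurent) set"
  where "laurent_cochains = {w. \<forall>J. w J \<in> loc J}"

lemma laurent_cochainsD: "w \<in> laurent_cochains \<Longrightarrow> w J \<in> loc J"
  by (simp add: laurent_cochains_def)

definition differential :: "('v::{finite,linorder} set \<Rightarrow> ('v, 'k::comm_ring_1) laurent) \<Rightarrow> 'v set \<Rightarrow> ('v, 'k) laurent"
  where "differential w K = (\<Sum>i\<in>K. face_sign i K * w (K - {i}))"

lemma differential_in_cochains:
  assumes "w \<in> laurent_cochains" shows "differential w \<in> laurent_cochains"
  unfolding laurent_cochains_def differential_def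
proof (intro CollectI allI loc_sum loc_mult face_sign_in_loc)
  fix K and i :: 'a
  show "w (K - {i}) \<in> loc K"
    using laurent_cochainsD[OF assms, of "K - {i}"] loc_mono[of "K - {i}" K] by auto
qed

lemma differential_add: "differential (\<lambda>J. w J + w' J) K = differential w K + differential w' K"
  by (simp add: differential_def sum.distrib distrib_left)

lemma differential_minus: "differential (\<lambda>J. w J - w' J) K = differential w K - differential w' K"
  by (simp add: differential_def sum_subtractf right_diff_distrib)

lemma differential_uminus: "differential (\<lambda>J. - w J) K = - differential w K"
  by (simp add: differential_def sum_negf)

lemma differential_zero [simp]: "differential (\<lambda>J. 0) K = 0"
  by (simp add: differential_def)

lemma differential_scale: "differential (\<lambda>J. c * w J) K = c * differential w K"
  by (simp add: differential_def sum_distrib_left mult.left_commute)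

lemma differential_empty [simp]: "differential w {} = 0"
  by (simp add: differential_def)

lemma differential_differential: "differential (differential w) K = 0"
proof -
  define T where "T i j = face_sign i K * face_sign j (K - {i}) * w (K - {i} - {j})" for i j
  have T: "T j i = - T i j" if "i \<in> K" "j \<in> K" "i \<noteq> j" for i j
  proof -
    have "K - {j} - {i} = K - {i} - {j}" by blast
    then show ?thesis unfolding T_def face_sign_swap[OF that] by simp
  qed
  define L where "L i j = (if i < j then T i j else 0)" for i j
  define G where "G i j = (if j < i then T i j else 0)" for i j
  have "differential (differential w) K = (\<Sum>i\<in>K. \<Sum>j\<in>K - {i}. T i j)"
    by (simp add: differential_def T_def sum_distrib_left mult.assoc)
  also have "\<dots> = (\<Sum>i\<in>K. \<Sum>j\<in>K. L i j + G i j)"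
  proof (rule sum.cong[OF refl])
    fix i assume "i \<in> K"
    have "(\<Sum>j\<in>K - {i}. T i j) = (\<Sum>j\<in>K - {i}. L i j + G i j)"
      by (rule sum.cong) (auto simp: L_def G_def)
    also have "\<dots> = (\<Sum>j\<in>K. L i j + G i j)"
      by (rule sum.mono_neutral_left) (auto simp: L_def G_def)
    finally show "(\<Sum>j\<in>K - {i}. T i j) = (\<Sum>j\<in>K. L i j + G i j)" .
  qed
  also have "\<dots> = (\<Sum>i\<in>K. \<Sum>j\<in>K. L i j) + (\<Sum>i\<in>K. \<Sum>j\<in>K. G i j)"
    by (simp add: sum.distrib)
  also have "(\<Sum>i\<in>K. \<Sum>j\<in>K. G i j) = (\<Sum>i\<in>K. \<Sum>j\<in>K. G j i)"
    by (rule sum.swap)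
  also have "(\<Sum>i\<in>K. \<Sum>j\<in>K. L i j) + (\<Sum>i\<in>K. \<Sum>j\<in>K. G j i) = (\<Sum>i\<in>K. \<Sum>j\<in>K. L i j + G j i)"
    by (simp add: sum.distrib)
  also have "\<dots> = 0"
  proof (intro sum.neutral ballI)
    fix i j assume "i \<in> K" "j \<in> K"
    then show "L i j + G j i = 0"
      using T[of i j] by (cases "i < j") (simp_all add: L_def G_def)
  qed
  finally show ?thesis .
qed

text \<open>
  The signs are compatible with Frobenius since \<open>(-1)\<^sup>p = -1\<close> in characteristic \<open>p\<close>, also for \<open>p = 2\<close>.
\<close>

lemma differential_frobenius:
  fixes w :: "'v::{finite,linorder} set \<Rightarrow> ('v, 'k::comm_ring_1) laurent"
  assumes p: "Factorial_Ring.prime p" "p = CHAR('k)"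
  shows "differential (\<lambda>J. w J ^ p) K = differential w K ^ p"
proof -
  have "(- 1 :: ('v, 'k) laurent) ^ p = - 1"
  proof -
    have "((1 + - 1) :: ('v, 'k) laurent) ^ p = 1 ^ p + (- 1) ^ p"
      using p by (intro freshmans_dream) simp_all
    then show ?thesis using prime_gt_0_nat[OF p(1)] by (simp add: zero_power add_eq_0_iff)
  qed
  then have "(face_sign i K :: ('v, 'k) laurent) ^ p = face_sign i K" for i
    by (cases "even (card {l \<in> K. l < i})") (simp_all add: face_sign_def)
  then have "(face_sign i K * w (K - {i})) ^ p = face_sign i K * w (K - {i}) ^ p" for i
    by (simp add: power_mult_distrib)
  moreover have "differential w K ^ p = (\<Sum>i\<in>K. (face_sign i K * w (K - {i})) ^ p)"
    unfolding differential_def using p by (intro freshmans_dream_sum) simp_all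
  ultimately show ?thesis by (simp add: differential_def)
qed

text \<open>
  A direction in which the monomial has no pole, if there is one. The Cech complex is graded by exponents, and in
  the degree \<open>a\<close> insertion of \<open>nonneg_dir a\<close> into index sets is a contracting homotopy.
\<close>

definition nonneg_dir :: "('v \<Rightarrow>\<^sub>0 int) \<Rightarrow> 'v"
  where "nonneg_dir a = (SOME i. 0 \<le> lookup a i)"

definition dir_part :: "'v \<Rightarrow> ('v, 'k::comm_ring_1) laurent \<Rightarrow> ('v, 'k) laurent"
  where "dir_part i = project (\<lambda>a. 0 \<le> lookup a i \<and> nonneg_dir a = i)"

lemma dir_part_in_loc:
  assumes "g \<in> loc J" shows "dir_part i g \<in> loc (J - {i})"
proof -
  have "v \<in> J - {i}" if a: "a \<in> keys (dir_part i g)" "lookup a v < 0" for a v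
  proof -
    have "a \<in> keys g" "0 \<le> lookup a i" using a(1) by (simp_all add: dir_part_def keys_project)
    then show ?thesis using assms a(2) by (auto simp: loc_def)
  qed
  then show ?thesis by (simp add: loc_def)
qed

lemma dir_part_sign: "dir_part i (face_sign j K * g) = face_sign j K * dir_part i g"
  by (simp add: dir_part_def project_sign)

lemma sum_dir_part:
  fixes g :: "('v::finite, 'k::comm_ring_1) laurent"
  assumes "g \<in> cech_image" shows "(\<Sum>i\<in>UNIV. dir_part i g) = g"
proof (rule poly_mapping_eqI)
  fix a :: "'v \<Rightarrow>\<^sub>0 int"
  have "lookup (\<Sum>i\<in>UNIV. dir_part i g) a
      = (\<Sum>i\<in>UNIV. if i = nonneg_dir a then (lookup g a when 0 \<le> lookup a (nonneg_dir a)) else 0)"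
    unfolding lookup_sum by (rule sum.cong) (auto simp: dir_part_def lookup_project when_def)
  also have "\<dots> = (lookup g a when 0 \<le> lookup a (nonneg_dir a))" by simp
  also have "\<dots> = lookup g a"
  proof (cases "a \<in> keys g")
    case True
    then have "\<exists>i. 0 \<le> lookup a i" using assms by (auto simp: cech_image_def)
    then have "0 \<le> lookup a (nonneg_dir a)" unfolding nonneg_dir_def by (rule someI_ex)
    then show ?thesis by simp
  qed (simp add: in_keys_iff when_def)
  finally show "lookup (\<Sum>i\<in>UNIV. dir_part i g) a = lookup g a" .
qed

lemma loc_subset_cech_image: "k \<notin> J \<Longrightarrow> loc J \<subseteq> cech_image"
  unfolding cech_image_def by (intro subsetI CollectI ballI exI[of _ k]) (rule locD)

text \<open>
  The vanishing of the \<open>n\<close>-th local cohomology of the polynomial ring in \<open>n + 1\<close> variables. The cochain \<open>v\<close> is the value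
  at \<open>w\<close> of the homotopy that, on a monomial \<open>x\<^sup>a\<close>, inserts \<open>nonneg_dir a\<close>. This does not leave \<open>loc J\<close>: a
  monomial without a pole in direction \<open>i\<close> that lies in \<open>loc (insert i J)\<close> already lies in \<open>loc J\<close>.
\<close>

lemma cech_exact:
  fixes w :: "'v::{finite,linorder} set \<Rightarrow> ('v, 'k::comm_ring_1) laurent"
  assumes w: "w \<in> laurent_cochains" and cocycle: "differential w UNIV = 0"
  obtains v where "v \<in> laurent_cochains" "\<And>k. w (UNIV - {k}) = differential v (UNIV - {k})"
proof -
  define v where "v J = (\<Sum>i\<in>UNIV - J. face_sign i (insert i J) * dir_part i (w (insert i J)))" for J
  have v: "v \<in> laurent_cochains"
    unfolding laurent_cochains_def v_def
  proof (intro CollectI allI loc_sum loc_mult face_sign_in_loc)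
    fix J and i :: 'v assume "i \<in> UNIV - J"
    then have "insert i J - {i} = J" by simp
    then show "dir_part i (w (insert i J)) \<in> loc J"
      using dir_part_in_loc[OF laurent_cochainsD[OF w, of "insert i J"], of i] by simp
  qed
  have "w (UNIV - {k}) = differential v (UNIV - {k})" for k
  proof -
    define J where "J = UNIV - {k}"
    \<comment> \<open>The complement of \<open>J - {j}\<close> is \<open>{j, k}\<close>: insertion of \<open>j\<close> gives back \<open>J\<close>, insertion of \<open>k\<close> gives \<open>UNIV - {j}\<close>.\<close>
    have summand: "face_sign j J * v (J - {j})
        = dir_part j (w J) - dir_part k (face_sign k UNIV * (face_sign j UNIV * w (UNIV - {j})))" if "j \<in> J" for j
    proof -
      have j: "j \<noteq> k" "UNIV - (J - {j}) = {j, k}" "insert j (J - {j}) = J" "insert k (J - {j}) = UNIV - {j}"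
        using that by (auto simp: J_def)
      have "v (J - {j}) = face_sign j J * dir_part j (w J) + face_sign k (UNIV - {j}) * dir_part k (w (UNIV - {j}))"
        unfolding v_def j(2) using j by simp
      then have "face_sign j J * v (J - {j})
          = (face_sign j J * face_sign j J) * dir_part j (w J)
            + (face_sign j J * face_sign k (UNIV - {j})) * dir_part k (w (UNIV - {j}))"
        by (simp only: distrib_left mult.assoc)
      also have "face_sign j J * face_sign k (UNIV - {j}) = - (face_sign k UNIV * face_sign j UNIV :: ('v, 'k) laurent)"
      proof -
        have swap: "(face_sign k UNIV * face_sign j J :: ('v, 'k) laurent) = - (face_sign j UNIV * face_sign k (UNIV - {j}))"
          unfolding J_def using j(1) by (intro face_sign_swap) auto
        have "face_sign j J * face_sign k (UNIV - {j})
            = (face_sign k UNIV * face_sign j J) * (face_sign k UNIV * face_sign k (UNIV - {j})) * (1 :: ('v, 'k) laurent)"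
          using face_sign_square[of k UNIV, where ?'b = 'k] by (simp add: ac_simps flip: mult.assoc[of "face_sign k UNIV" "face_sign k UNIV"])
        also have "\<dots> = - (face_sign j UNIV * face_sign k UNIV) * (face_sign k (UNIV - {j}) * face_sign k (UNIV - {j}))"
          unfolding swap by (simp add: ac_simps)
        finally show ?thesis by (simp add: mult.commute)
      qed
      finally show ?thesis by (simp add: dir_part_sign mult.assoc)
    qed
    have sum: "dir_part i (sum g I) = (\<Sum>j\<in>I. dir_part i (g j))" for i g and I :: "'v set"
      by (simp add: dir_part_def project_sum)
    have "differential w UNIV = face_sign k UNIV * w J + (\<Sum>j\<in>J. face_sign j UNIV * w (UNIV - {j}))"
      unfolding differential_def J_def by (simp add: sum.remove[of UNIV k])
    then have rest: "(\<Sum>j\<in>J. face_sign j UNIV * w (UNIV - {j})) = - (face_sign k UNIV * w J)"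
      using cocycle by (simp add: add_eq_0_iff)
    have "differential v J = (\<Sum>j\<in>J. dir_part j (w J))
        - dir_part k (face_sign k UNIV * (\<Sum>j\<in>J. face_sign j UNIV * w (UNIV - {j})))"
      unfolding differential_def using summand
      by (simp add: sum_subtractf sum sum_distrib_left)
    also have "dir_part k (face_sign k UNIV * (\<Sum>j\<in>J. face_sign j UNIV * w (UNIV - {j}))) = - dir_part k (w J)"
      unfolding rest using project_minus[of "\<lambda>a. 0 \<le> lookup a k \<and> nonneg_dir a = k" 0 "w J"]
      by (simp add: dir_part_def flip: mult.assoc)
    also have "(\<Sum>j\<in>J. dir_part j (w J)) - - dir_part k (w J) = (\<Sum>j\<in>UNIV. dir_part j (w J))"
      by (simp add: J_def sum.remove[of UNIV k])
    also have "\<dots> = w J"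
      using laurent_cochainsD[OF w, of J] loc_subset_cech_image[of k J]
      by (intro sum_dir_part) (auto simp: J_def)
    finally show ?thesis by (simp add: J_def)
  qed
  with v show ?thesis by (rule that)
qed

section \<open>Cochains of the hypersurface ring\<close>

abbreviation cochain_group :: "('v::{finite,linorder}, 'k::field) mpoly \<Rightarrow> nat \<Rightarrow> ('v set \<Rightarrow> (('v, 'k) mpoly set \<times> ('v, 'k) mpoly set) set) monoid"
  where "cochain_group f q \<equiv> cech_cochains (hypersurface_ring f) (hvar f) q"

definition cochain_class :: "('v::{finite,linorder}, 'k::field) mpoly \<Rightarrow> nat \<Rightarrow> ('v set \<Rightarrow> ('v, 'k) laurent) \<Rightarrow> 'v set \<Rightarrow> (('v, 'k) mpoly set \<times> ('v, 'k) mpoly set) set"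
  where "cochain_class f q w = (\<lambda>J\<in>{J. card J = q}. lclass f J (w J))"

lemma cochain_class_eq_iff:
  assumes "w \<in> laurent_cochains" "w' \<in> laurent_cochains"
  shows "cochain_class f q w = cochain_class f q w' \<longleftrightarrow> (\<forall>J. card J = q \<longrightarrow> w J - w' J \<in> multiples f J)"
proof -
  have "cochain_class f q w = cochain_class f q w' \<longleftrightarrow> (\<forall>J. card J = q \<longrightarrow> lclass f J (w J) = lclass f J (w' J))"
    unfolding cochain_class_def fun_eq_iff restrict_def by auto
  then show ?thesis using assms by (simp add: lclass_eq_iff laurent_cochainsD)
qed

lemma carrier_cochain_group: "carrier (cochain_group f q) = cochain_class f q ` laurent_cochains"
proof (intro equalityI subsetI)
  fix z assume "z \<in> carrier (cochain_group f q)"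
  then have z: "z \<in> (\<Pi>\<^sub>E J\<in>{J. card J = q}. lclass f J ` loc J)"
    by (simp add: cech_cochains_def carrier_hloc)
  then have "\<forall>J. \<exists>g. card J = q \<longrightarrow> g \<in> loc J \<and> z J = lclass f J g"
    by (auto simp: PiE_def Pi_def)
  then obtain w where w: "\<And>J. card J = q \<Longrightarrow> w J \<in> loc J \<and> z J = lclass f J (w J)" by metis
  define w' where "w' J = (if card J = q then w J else 0)" for J
  have "w' \<in> laurent_cochains" using w by (simp add: laurent_cochains_def w'_def)
  moreover have "z = cochain_class f q w'"
  proof
    fix J show "z J = cochain_class f q w' J"
      using z w[of J] by (cases "card J = q") (auto simp: cochain_class_def w'_def PiE_def extensional_def)
  qed
  ultimately show "z \<in> cochain_class f q ` laurent_cochains" by blast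
next
  fix z assume "z \<in> cochain_class f q ` laurent_cochains"
  then show "z \<in> carrier (cochain_group f q)"
    by (auto simp: cech_cochains_def carrier_hloc cochain_class_def laurent_cochainsD)
qed

lemma cochain_class_mult:
  assumes "w \<in> laurent_cochains" "w' \<in> laurent_cochains"
  shows "cochain_class f q w \<otimes>\<^bsub>cochain_group f q\<^esub> cochain_class f q w' = cochain_class f q (\<lambda>J. w J + w' J)"
proof
  fix J show "(cochain_class f q w \<otimes>\<^bsub>cochain_group f q\<^esub> cochain_class f q w') J = cochain_class f q (\<lambda>J. w J + w' J) J"
    using hloc_add[OF laurent_cochainsD[OF assms(1), of J] laurent_cochainsD[OF assms(2), of J], of f]
    by (simp add: cech_cochains_def cochain_class_def restrict_def)
qed

lemma cochain_class_one: "\<one>\<^bsub>cochain_group f q\<^esub> = cochain_class f q (\<lambda>J. 0)"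
  by (simp add: cech_cochains_def cochain_class_def hloc_zero restrict_def)

lemma laurent_cochains_add: "w \<in> laurent_cochains \<Longrightarrow> w' \<in> laurent_cochains \<Longrightarrow> (\<lambda>J. w J + w' J) \<in> laurent_cochains"
  by (simp add: laurent_cochains_def loc_add)

lemma laurent_cochains_uminus: "w \<in> laurent_cochains \<Longrightarrow> (\<lambda>J. - w J) \<in> laurent_cochains"
  by (simp add: laurent_cochains_def)

lemma laurent_cochains_zero: "(\<lambda>J. 0) \<in> laurent_cochains"
  by (simp add: laurent_cochains_def)

lemma laurent_cochains_power: "w \<in> laurent_cochains \<Longrightarrow> (\<lambda>J. w J ^ n) \<in> laurent_cochains"
  by (simp add: laurent_cochains_def loc_power)

lemma cochain_group_comm_group: "comm_group (cochain_group f q)"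
proof (rule comm_groupI)
  fix x y z assume x: "x \<in> carrier (cochain_group f q)"
  obtain w where w: "w \<in> laurent_cochains" "x = cochain_class f q w"
    using x by (auto simp: carrier_cochain_group)
  show "\<one>\<^bsub>cochain_group f q\<^esub> \<otimes>\<^bsub>cochain_group f q\<^esub> x = x"
    by (simp add: w cochain_class_one cochain_class_mult laurent_cochains_zero)
  have "cochain_class f q (\<lambda>J. - w J) \<otimes>\<^bsub>cochain_group f q\<^esub> x = \<one>\<^bsub>cochain_group f q\<^esub>"
    by (simp add: w cochain_class_one cochain_class_mult laurent_cochains_uminus)
  then show "\<exists>y\<in>carrier (cochain_group f q). y \<otimes>\<^bsub>cochain_group f q\<^esub> x = \<one>\<^bsub>cochain_group f q\<^esub>"
    using laurent_cochains_uminus[OF w(1)] by (auto simp: carrier_cochain_group)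
  assume y: "y \<in> carrier (cochain_group f q)"
  obtain w' where w': "w' \<in> laurent_cochains" "y = cochain_class f q w'"
    using y by (auto simp: carrier_cochain_group)
  show "x \<otimes>\<^bsub>cochain_group f q\<^esub> y \<in> carrier (cochain_group f q)"
    using laurent_cochains_add[OF w(1) w'(1)] by (simp add: w w' cochain_class_mult carrier_cochain_group)
  show "x \<otimes>\<^bsub>cochain_group f q\<^esub> y = y \<otimes>\<^bsub>cochain_group f q\<^esub> x"
    by (simp add: w w' cochain_class_mult add.commute)
  assume z: "z \<in> carrier (cochain_group f q)"
  obtain w'' where w'': "w'' \<in> laurent_cochains" "z = cochain_class f q w''"
    using z by (auto simp: carrier_cochain_group)
  show "x \<otimes>\<^bsub>cochain_group f q\<^esub> y \<otimes>\<^bsub>cochain_group f q\<^esub> z = x \<otimes>\<^bsub>cochain_group f q\<^esub> (y \<otimes>\<^bsub>cochain_group f q\<^esub> z)"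
    by (simp add: w w' w'' cochain_class_mult laurent_cochains_add add.assoc)
next
  show "\<one>\<^bsub>cochain_group f q\<^esub> \<in> carrier (cochain_group f q)"
    using laurent_cochains_zero by (auto simp: cochain_class_one carrier_cochain_group)
qed

lemma cochain_class_inv:
  assumes "w \<in> laurent_cochains"
  shows "inv\<^bsub>cochain_group f q\<^esub> cochain_class f q w = cochain_class f q (\<lambda>J. - w J)"
proof -
  interpret G: comm_group "cochain_group f q" by (rule cochain_group_comm_group)
  show ?thesis
    by (rule G.inv_equality)
       (use assms in \<open>simp_all add: cochain_class_mult cochain_class_one laurent_cochains_uminus carrier_cochain_group\<close>)
qed

lemma cech_differential_class:
  assumes w: "w \<in> laurent_cochains"
  shows "cech_differential (hypersurface_ring f) (hvar f) q (cochain_class f q w) = cochain_class f (q + 1) (differential w)"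
proof
  fix K
  show "cech_differential (hypersurface_ring f) (hvar f) q (cochain_class f q w) K = cochain_class f (q + 1) (differential w) K"
  proof (cases "card K = q + 1")
    case True
    interpret G: abelian_group "hloc f K" by (rule hloc_abelian_group)
    have loc: "w (K - {i}) \<in> loc K" for i
      using laurent_cochainsD[OF w, of "K - {i}"] loc_mono[of "K - {i}" K] by auto
    have summand: "(let y = localization_map (hypersurface_ring f) (denominators (hypersurface_ring f) (hvar f) K) (\<lambda>a. a)
            (cochain_class f q w (K - {i}))
         in if even (card {l \<in> K. l < i}) then y else \<ominus>\<^bsub>hloc f K\<^esub> y) = lclass f K (face_sign i K * w (K - {i}))"
      if "i \<in> K" for i
    proof -
      have "card (K - {i}) = q" using that True by simp
      then have "localization_map (hypersurface_ring f) (denominators (hypersurface_ring f) (hvar f) K) (\<lambda>a. a)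
            (cochain_class f q w (K - {i})) = lclass f K (w (K - {i}))"
        using laurent_cochainsD[OF w, of "K - {i}"] by (simp add: cochain_class_def localization_map_inclusion)
      then show ?thesis
        using loc by (cases "even (card {l \<in> K. l < i})") (simp_all add: face_sign_def hloc_a_inv)
    qed
    have "cech_differential (hypersurface_ring f) (hvar f) q (cochain_class f q w) K
      = (\<Oplus>\<^bsub>hloc f K\<^esub>i\<in>K. lclass f K (face_sign i K * w (K - {i})))"
      using True unfolding cech_differential_def
      by (simp only: restrict_apply mem_Collect_eq if_True simp_thms)
         (rule G.finsum_cong', use loc summand in \<open>auto simp: carrier_hloc intro!: loc_mult\<close>)
    also have "\<dots> = lclass f K (differential w K)"
      unfolding differential_def using loc by (intro hloc_finsum loc_mult) simp_all
    finally show ?thesis using True by (simp add: cochain_class_def)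
  qed (simp add: cech_differential_def cochain_class_def)
qed

definition laurent_cocycles :: "('v::{finite,linorder}, 'k::field) mpoly \<Rightarrow> nat \<Rightarrow> ('v set \<Rightarrow> ('v, 'k) laurent) set"
  where "laurent_cocycles f q =
    {w \<in> laurent_cochains. \<forall>K. card K = q + 1 \<longrightarrow> differential w K \<in> multiples f K}"

lemma cochain_class_cocycle_iff:
  assumes "w \<in> laurent_cochains"
  shows "cochain_class f q w \<in> cech_cocycles (hypersurface_ring f) (hvar f) q \<longleftrightarrow> w \<in> laurent_cocycles f q"
proof -
  have "cech_differential (hypersurface_ring f) (hvar f) q (cochain_class f q w) = \<one>\<^bsub>cochain_group f (q + 1)\<^esub>
    \<longleftrightarrow> (\<forall>K. card K = q + 1 \<longrightarrow> differential w K \<in> multiples f K)"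
    unfolding cech_differential_class[OF assms] cochain_class_one
    using cochain_class_eq_iff[OF differential_in_cochains[OF assms] laurent_cochains_zero] by simp
  moreover have "cochain_class f q w \<in> carrier (cochain_group f q)"
    unfolding carrier_cochain_group using assms by (rule imageI)
  ultimately show ?thesis
    using assms by (simp add: cech_cocycles_def kernel_def laurent_cocycles_def)
qed

lemma laurent_cocycles_subset: "laurent_cocycles f q \<subseteq> laurent_cochains"
  by (auto simp: laurent_cocycles_def)

lemma cech_cocycles_eq:
  "cech_cocycles (hypersurface_ring f) (hvar f) q = cochain_class f q ` laurent_cocycles f q"
proof (intro equalityI subsetI)
  fix z assume z: "z \<in> cech_cocycles (hypersurface_ring f) (hvar f) q"
  then have "z \<in> carrier (cochain_group f q)" by (simp add: cech_cocycles_def kernel_def)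
  then obtain w where w: "w \<in> laurent_cochains" "z = cochain_class f q w"
    by (auto simp: carrier_cochain_group)
  then show "z \<in> cochain_class f q ` laurent_cocycles f q"
    using z cochain_class_cocycle_iff by blast
next
  fix z assume "z \<in> cochain_class f q ` laurent_cocycles f q"
  then obtain w where "w \<in> laurent_cocycles f q" "z = cochain_class f q w" by blast
  then show "z \<in> cech_cocycles (hypersurface_ring f) (hvar f) q"
    using cochain_class_cocycle_iff[of w f q] by (simp add: laurent_cocycles_def)
qed

text \<open>
  The case \<open>q = 0\<close> fits in because the only index set is empty there and the differential vanishes on it.
\<close>

lemma cech_coboundaries_eq:
  "cech_coboundaries (hypersurface_ring f) (hvar f) q = cochain_class f q ` differential ` laurent_cochains"
proof (cases q)
  case 0
  have "cochain_class f 0 (differential w) = cochain_class f 0 (\<lambda>J. 0)" for w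
    by (rule ext) (auto simp: cochain_class_def restrict_def)
  moreover have "cochain_class f 0 (\<lambda>J. 0) \<in> cochain_class f 0 ` differential ` laurent_cochains"
    using laurent_cochains_zero by (intro image_eqI[of _ _ "\<lambda>J. 0"]) (auto simp: fun_eq_iff)
  ultimately have "cochain_class f 0 ` differential ` laurent_cochains = {cochain_class f 0 (\<lambda>J. 0)}"
    by blast
  then show ?thesis
    unfolding cech_coboundaries_def 0 by (simp add: cochain_class_one)
next
  case (Suc r)
  then show ?thesis
    unfolding cech_coboundaries_def carrier_cochain_group
    by (simp add: image_image cech_differential_class)
qed

lemma cech_frobenius_class:
  fixes f :: "('v::{finite,linorder}, 'k::field) mpoly"
  assumes p: "Factorial_Ring.prime p" "p = CHAR('k)" and w: "w \<in> laurent_cochains"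
  shows "cech_frobenius (hypersurface_ring f) (hvar f) p q (cochain_class f q w) = cochain_class f q (\<lambda>J. w J ^ p)"
  unfolding cech_frobenius_def cochain_class_def
  using localization_map_frobenius[OF p laurent_cochainsD[OF w]] by (simp add: restrict_def cong: if_cong)

section \<open>Local cohomology of the hypersurface ring\<close>

lemma laurent_cocyclesD: "w \<in> laurent_cocycles f q \<Longrightarrow> w \<in> laurent_cochains"
  using laurent_cocycles_subset by blast

lemma laurent_cocycles_add:
  "w \<in> laurent_cocycles f q \<Longrightarrow> w' \<in> laurent_cocycles f q \<Longrightarrow> (\<lambda>J. w J + w' J) \<in> laurent_cocycles f q"
  by (simp add: laurent_cocycles_def laurent_cochains_add differential_add multiples_add)

lemma laurent_cocycles_uminus: "w \<in> laurent_cocycles f q \<Longrightarrow> (\<lambda>J. - w J) \<in> laurent_cocycles f q"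
  by (simp add: laurent_cocycles_def laurent_cochains_uminus differential_uminus)

lemma laurent_cocycles_zero: "(\<lambda>J. 0) \<in> laurent_cocycles f q"
  by (simp add: laurent_cocycles_def laurent_cochains_zero)

lemma laurent_cocycles_differential: "v \<in> laurent_cochains \<Longrightarrow> differential v \<in> laurent_cocycles f q"
  by (simp add: laurent_cocycles_def differential_in_cochains differential_differential)

lemma laurent_cocycles_power:
  fixes f :: "('v::{finite,linorder}, 'k::field) mpoly"
  assumes p: "Factorial_Ring.prime p" "p = CHAR('k)" and w: "w \<in> laurent_cocycles f q"
  shows "(\<lambda>J. w J ^ p) \<in> laurent_cocycles f q"
  using w multiples_power_diff[OF p, of _ 0 f] prime_gt_0_nat[OF p(1)]
  by (simp add: laurent_cocycles_def laurent_cochains_power differential_frobenius[OF p] zero_power)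

abbreviation coboundaries :: "('v::{finite,linorder}, 'k::field) mpoly \<Rightarrow> nat \<Rightarrow> ('v set \<Rightarrow> (('v, 'k) mpoly set \<times> ('v, 'k) mpoly set) set) set"
  where "coboundaries f q \<equiv> cech_coboundaries (hypersurface_ring f) (hvar f) q"

abbreviation cocycle_group :: "('v::{finite,linorder}, 'k::field) mpoly \<Rightarrow> nat \<Rightarrow> ('v set \<Rightarrow> (('v, 'k) mpoly set \<times> ('v, 'k) mpoly set) set) monoid"
  where "cocycle_group f q \<equiv> (cochain_group f q)\<lparr>carrier := cech_cocycles (hypersurface_ring f) (hvar f) q\<rparr>"

abbreviation cohomology :: "('v::{finite,linorder}, 'k::field) mpoly \<Rightarrow> nat \<Rightarrow> ('v set \<Rightarrow> (('v, 'k) mpoly set \<times> ('v, 'k) mpoly set) set) set monoid"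
  where "cohomology f q \<equiv> local_cohomology (hypersurface_ring f) (hvar f) q"

definition cohomology_class :: "('v::{finite,linorder}, 'k::field) mpoly \<Rightarrow> nat \<Rightarrow> ('v set \<Rightarrow> ('v, 'k) laurent) \<Rightarrow> ('v set \<Rightarrow> (('v, 'k) mpoly set \<times> ('v, 'k) mpoly set) set) set"
  where "cohomology_class f q w = coboundaries f q #>\<^bsub>cochain_group f q\<^esub> cochain_class f q w"

lemma subgroup_coboundaries: "subgroup (coboundaries f q) (cochain_group f q)"
proof -
  interpret C: comm_group "cochain_group f q" by (rule cochain_group_comm_group)
  show ?thesis
  proof (rule C.subgroupI)
    show "coboundaries f q \<subseteq> carrier (cochain_group f q)"
      unfolding cech_coboundaries_eq carrier_cochain_group using differential_in_cochains by blast
    show "coboundaries f q \<noteq> {}"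
      unfolding cech_coboundaries_eq using laurent_cochains_zero by blast
  next
    fix a assume "a \<in> coboundaries f q"
    then obtain v where v: "v \<in> laurent_cochains" "a = cochain_class f q (differential v)"
      unfolding cech_coboundaries_eq by blast
    have "inv\<^bsub>cochain_group f q\<^esub> a = cochain_class f q (differential (\<lambda>J. - v J))"
      by (simp add: v cochain_class_inv differential_in_cochains differential_uminus[abs_def])
    then show "inv\<^bsub>cochain_group f q\<^esub> a \<in> coboundaries f q"
      unfolding cech_coboundaries_eq using laurent_cochains_uminus[OF v(1)] by blast
    fix b assume "b \<in> coboundaries f q"
    then obtain v' where v': "v' \<in> laurent_cochains" "b = cochain_class f q (differential v')"
      unfolding cech_coboundaries_eq by blast
    have "a \<otimes>\<^bsub>cochain_group f q\<^esub> b = cochain_class f q (differential (\<lambda>J. v J + v' J))"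
      by (simp add: v v' cochain_class_mult differential_in_cochains differential_add[abs_def])
    then show "a \<otimes>\<^bsub>cochain_group f q\<^esub> b \<in> coboundaries f q"
      unfolding cech_coboundaries_eq using laurent_cochains_add[OF v(1) v'(1)] by blast
  qed
qed

lemma subgroup_cocycles: "subgroup (cech_cocycles (hypersurface_ring f) (hvar f) q) (cochain_group f q)"
proof -
  interpret C: comm_group "cochain_group f q" by (rule cochain_group_comm_group)
  show ?thesis
  proof (rule C.subgroupI)
    show "cech_cocycles (hypersurface_ring f) (hvar f) q \<subseteq> carrier (cochain_group f q)"
      by (auto simp: cech_cocycles_def kernel_def)
    show "cech_cocycles (hypersurface_ring f) (hvar f) q \<noteq> {}"
      unfolding cech_cocycles_eq using laurent_cocycles_zero by blast
  next
    fix a assume "a \<in> cech_cocycles (hypersurface_ring f) (hvar f) q"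
    then obtain w where w: "w \<in> laurent_cocycles f q" "a = cochain_class f q w"
      unfolding cech_cocycles_eq by blast
    show "inv\<^bsub>cochain_group f q\<^esub> a \<in> cech_cocycles (hypersurface_ring f) (hvar f) q"
      unfolding cech_cocycles_eq using w laurent_cocycles_uminus[OF w(1)]
      by (simp add: cochain_class_inv laurent_cocyclesD)
    fix b assume "b \<in> cech_cocycles (hypersurface_ring f) (hvar f) q"
    then obtain w' where w': "w' \<in> laurent_cocycles f q" "b = cochain_class f q w'"
      unfolding cech_cocycles_eq by blast
    show "a \<otimes>\<^bsub>cochain_group f q\<^esub> b \<in> cech_cocycles (hypersurface_ring f) (hvar f) q"
      unfolding cech_cocycles_eq using w w' laurent_cocycles_add[OF w(1) w'(1)]
      by (simp add: cochain_class_mult laurent_cocyclesD)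
  qed
qed

lemma coboundaries_normal: "coboundaries f q \<lhd> cocycle_group f q"
proof -
  interpret C: comm_group "cochain_group f q" by (rule cochain_group_comm_group)
  interpret Z: comm_group "cocycle_group f q"
  proof (rule group.group_comm_groupI)
    show "group (cocycle_group f q)" by (rule C.subgroup_imp_group[OF subgroup_cocycles])
    show "x \<otimes>\<^bsub>cocycle_group f q\<^esub> y = y \<otimes>\<^bsub>cocycle_group f q\<^esub> x"
      if "x \<in> carrier (cocycle_group f q)" "y \<in> carrier (cocycle_group f q)" for x y
      using that C.m_comm[OF subgroup.mem_carrier[OF subgroup_cocycles] subgroup.mem_carrier[OF subgroup_cocycles]]
      by simp
  qed
  have "coboundaries f q \<subseteq> cech_cocycles (hypersurface_ring f) (hvar f) q"
    unfolding cech_coboundaries_eq cech_cocycles_eq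
    by (intro image_mono image_subsetI laurent_cocycles_differential)
  then show ?thesis
    by (intro Z.subgroup_imp_normal C.subgroup_incl subgroup_coboundaries subgroup_cocycles)
qed

lemma cohomology_group: "group (cohomology f q)"
  unfolding local_cohomology_def by (rule normal.factorgroup_is_group[OF coboundaries_normal])

lemma carrier_cohomology: "carrier (cohomology f q) = cohomology_class f q ` laurent_cocycles f q"
  unfolding local_cohomology_def FactGroup_def RCOSETS_def
  by (auto simp: cech_cocycles_eq cohomology_class_def r_coset_def)

lemma cohomology_class_mult:
  assumes w: "w \<in> laurent_cocycles f q" "w' \<in> laurent_cocycles f q"
  shows "cohomology_class f q w \<otimes>\<^bsub>cohomology f q\<^esub> cohomology_class f q w'
    = cohomology_class f q (\<lambda>J. w J + w' J)"
proof -
  interpret B: normal "coboundaries f q" "cocycle_group f q" by (rule coboundaries_normal)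
  have coset: "coboundaries f q #>\<^bsub>cocycle_group f q\<^esub> x = coboundaries f q #>\<^bsub>cochain_group f q\<^esub> x" for x
    by (simp add: r_coset_def)
  have "cochain_class f q w \<in> carrier (cocycle_group f q)" "cochain_class f q w' \<in> carrier (cocycle_group f q)"
    using w by (auto simp: cech_cocycles_eq)
  from B.rcos_sum[OF this] show ?thesis
    using w unfolding coset cohomology_class_def
    by (simp add: local_cohomology_def FactGroup_def cochain_class_mult laurent_cocyclesD)
qed

lemma cohomology_one: "\<one>\<^bsub>cohomology f q\<^esub> = coboundaries f q"
  by (simp add: local_cohomology_def FactGroup_def)

lemma cohomology_class_eq_one_iff:
  assumes "w \<in> laurent_cochains"
  shows "cohomology_class f q w = \<one>\<^bsub>cohomology f q\<^esub> \<longleftrightarrow> cochain_class f q w \<in> coboundaries f q"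
proof -
  interpret C: comm_group "cochain_group f q" by (rule cochain_group_comm_group)
  have "cochain_class f q w \<in> carrier (cochain_group f q)"
    unfolding carrier_cochain_group using assms by (rule imageI)
  from C.coset_join1[OF _ this subgroup_coboundaries] C.coset_join2[OF this subgroup_coboundaries]
  show ?thesis
    unfolding cohomology_one cohomology_class_def by (rule iffI)
qed

lemma cohomology_class_zero: "cohomology_class f q (\<lambda>J. 0) = \<one>\<^bsub>cohomology f q\<^esub>"
  unfolding cohomology_class_eq_one_iff[OF laurent_cochains_zero]
  using subgroup.one_closed[OF subgroup_coboundaries] by (simp only: cochain_class_one)

lemma cohomology_class_inv:
  assumes "w \<in> laurent_cocycles f q"
  shows "inv\<^bsub>cohomology f q\<^esub> cohomology_class f q w = cohomology_class f q (\<lambda>J. - w J)"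
proof -
  interpret Q: group "cohomology f q" by (rule cohomology_group)
  show ?thesis
    by (rule Q.inv_equality)
       (use assms in \<open>simp_all add: cohomology_class_mult laurent_cocycles_uminus cohomology_class_zero carrier_cohomology\<close>)
qed

lemma cohomology_class_shift:
  assumes "v \<in> laurent_cochains" "w \<in> laurent_cochains"
  shows "cohomology_class f q (\<lambda>J. differential v J + w J) = cohomology_class f q w"
proof -
  interpret C: comm_group "cochain_group f q" by (rule cochain_group_comm_group)
  let ?b = "cochain_class f q (differential v)"
  have b: "?b \<in> coboundaries f q" unfolding cech_coboundaries_eq using assms(1) by blast
  have carr: "?b \<in> carrier (cochain_group f q)" "cochain_class f q w \<in> carrier (cochain_group f q)"
    unfolding carrier_cochain_group using assms by (auto intro: differential_in_cochains)
  have "cohomology_class f q (\<lambda>J. differential v J + w J)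
      = coboundaries f q #>\<^bsub>cochain_group f q\<^esub> (?b \<otimes>\<^bsub>cochain_group f q\<^esub> cochain_class f q w)"
    using assms by (simp add: cohomology_class_def cochain_class_mult differential_in_cochains)
  also have "\<dots> = (coboundaries f q #>\<^bsub>cochain_group f q\<^esub> ?b) #>\<^bsub>cochain_group f q\<^esub> cochain_class f q w"
    by (rule C.coset_mult_assoc[OF subgroup.subset[OF subgroup_coboundaries] carr, symmetric])
  also have "coboundaries f q #>\<^bsub>cochain_group f q\<^esub> ?b = coboundaries f q"
    using carr b by (intro C.coset_join2 subgroup_coboundaries)
  finally show ?thesis by (simp add: cohomology_class_def)
qed

lemma frobenius_action_class:
  fixes f :: "('v::{finite,linorder}, 'k::field) mpoly"
  assumes p: "Factorial_Ring.prime p" "p = CHAR('k)" and w: "w \<in> laurent_cochains"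
  shows "frobenius_action (hypersurface_ring f) (hvar f) p q (cohomology_class f q w)
    = cohomology_class f q (\<lambda>J. w J ^ p)"
proof -
  interpret C: comm_group "cochain_group f q" by (rule cochain_group_comm_group)
  have const: "coboundaries f q #>\<^bsub>cochain_group f q\<^esub> cech_frobenius (hypersurface_ring f) (hvar f) p q z
      = cohomology_class f q (\<lambda>J. w J ^ p)" if z_in: "z \<in> cohomology_class f q w" for z
  proof -
    obtain v where v: "v \<in> laurent_cochains"
      "z = cochain_class f q (differential v) \<otimes>\<^bsub>cochain_group f q\<^esub> cochain_class f q w"
      using z_in unfolding cohomology_class_def r_coset_def cech_coboundaries_eq by blast
    have z: "z = cochain_class f q (\<lambda>J. differential v J + w J)"
      using v w by (simp add: cochain_class_mult differential_in_cochains)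
    have "(differential v J + w J) ^ p = differential (\<lambda>J. v J ^ p) J + w J ^ p" for J
      unfolding differential_frobenius[OF p] using p by (intro freshmans_dream) simp_all
    then have "cech_frobenius (hypersurface_ring f) (hvar f) p q z
        = cochain_class f q (\<lambda>J. differential (\<lambda>J. v J ^ p) J + w J ^ p)"
      unfolding z using v w
      by (subst cech_frobenius_class[OF p]) (simp_all add: laurent_cochains_add differential_in_cochains)
    then show ?thesis
      using cohomology_class_shift[OF laurent_cochains_power[OF v(1), of p] laurent_cochains_power[OF w, of p], of f q]
      by (simp add: cohomology_class_def)
  qed
  moreover have "cochain_class f q w \<in> cohomology_class f q w"
    unfolding cohomology_class_def
    by (intro C.rcos_self subgroup_coboundaries) (auto simp: carrier_cochain_group w)
  ultimately show ?thesis unfolding frobenius_action_def by blast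
qed

lemma loc_piece_power: "g \<in> loc_piece J i \<Longrightarrow> g ^ n \<in> loc_piece J (int n * i)"
  using keys_power_total_degree[of g i n] by (simp add: loc_piece_def loc_power)

text \<open>
  The representative is set to zero on the index sets that do not occur in degree \<open>q\<close>, so that it is homogeneous everywhere.
\<close>

lemma local_cohomology_piece_eq:
  assumes f: "f \<in> homogeneous_polys d"
  shows "local_cohomology_piece (hypersurface_ring f) (residue_grading f) (hvar f) q i
    = cohomology_class f q ` {w \<in> laurent_cocycles f q. \<forall>J. w J \<in> loc_piece J i}"
proof (intro equalityI subsetI)
  fix U assume "U \<in> local_cohomology_piece (hypersurface_ring f) (residue_grading f) (hvar f) q i"
  then obtain z where z: "z \<in> cech_cocycles (hypersurface_ring f) (hvar f) q"
    "\<And>J. card J = q \<Longrightarrow> z J \<in> lclass f J ` loc_piece J i"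
    "U = coboundaries f q #>\<^bsub>cochain_group f q\<^esub> z"
    unfolding local_cohomology_piece_def localization_piece_eq[OF f] by blast
  have "\<forall>J. \<exists>g. card J = q \<longrightarrow> g \<in> loc_piece J i \<and> z J = lclass f J g" using z(2) by blast
  then obtain w where w: "\<And>J. card J = q \<Longrightarrow> w J \<in> loc_piece J i \<and> z J = lclass f J (w J)" by metis
  define w' where "w' J = (if card J = q then w J else 0)" for J
  have w': "w' J \<in> loc_piece J i" for J using w by (simp add: w'_def loc_piece_def)
  then have coch: "w' \<in> laurent_cochains" by (simp add: laurent_cochains_def loc_piece_def)
  have "z = cochain_class f q w'"
  proof
    fix J show "z J = cochain_class f q w' J"
    proof (cases "card J = q")
      case True
      then show ?thesis using w by (simp add: cochain_class_def w'_def)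
    next
      case False
      obtain z0 where "z = cochain_class f q z0" using z(1) unfolding cech_cocycles_eq by blast
      then show ?thesis using False by (simp add: cochain_class_def)
    qed
  qed
  moreover from this have "w' \<in> laurent_cocycles f q"
    using z(1) cochain_class_cocycle_iff[OF coch] by simp
  ultimately show "U \<in> cohomology_class f q ` {w \<in> laurent_cocycles f q. \<forall>J. w J \<in> loc_piece J i}"
    using w' z(3) unfolding cohomology_class_def by blast
next
  fix U assume "U \<in> cohomology_class f q ` {w \<in> laurent_cocycles f q. \<forall>J. w J \<in> loc_piece J i}"
  then obtain w where w: "w \<in> laurent_cocycles f q" "\<And>J. w J \<in> loc_piece J i" "U = cohomology_class f q w"
    by blast
  have "cochain_class f q w J \<in> lclass f J ` loc_piece J i" if "card J = q" for J
    using that w(2) by (simp add: cochain_class_def)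
  moreover have "cochain_class f q w \<in> cech_cocycles (hypersurface_ring f) (hvar f) q"
    unfolding cech_cocycles_eq using w(1) by blast
  ultimately show "U \<in> local_cohomology_piece (hypersurface_ring f) (residue_grading f) (hvar f) q i"
    unfolding local_cohomology_piece_def localization_piece_eq[OF f] w(3) cohomology_class_def by blast
qed

section \<open>The connecting map to the top local cohomology of the polynomial ring\<close>

text \<open>
  If \<open>w = \<delta> v + f h\<close>, then \<open>f g = \<delta> w = f \<delta> h\<close>, and \<open>f\<close> can be cancelled.
\<close>

lemma coboundary_imp_cech_image:
  fixes f :: "('v::{finite,linorder}, 'k::field) mpoly"
  assumes card: "card (UNIV :: 'v set) = n + 1" and f: "f \<noteq> 0"
    and w: "w \<in> laurent_cochains" "cochain_class f n w \<in> coboundaries f n"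
    and g: "differential w UNIV = laurent f * g"
  shows "g \<in> cech_image"
proof -
  obtain v where v: "v \<in> laurent_cochains" "cochain_class f n w = cochain_class f n (differential v)"
    using w(2) unfolding cech_coboundaries_eq by blast
  have "w (UNIV - {i}) - differential v (UNIV - {i}) \<in> multiples f (UNIV - {i})" for i
    using v(2) card unfolding cochain_class_eq_iff[OF w(1) differential_in_cochains[OF v(1)]] by simp
  then have "\<forall>i. \<exists>h. h \<in> loc (UNIV - {i}) \<and> w (UNIV - {i}) - differential v (UNIV - {i}) = laurent f * h"
    unfolding multiples_def by blast
  then obtain h where h: "\<And>i. h i \<in> loc (UNIV - {i})"
    "\<And>i. w (UNIV - {i}) - differential v (UNIV - {i}) = laurent f * h i"
    by metis
  have "laurent f * g = differential (\<lambda>J. w J - differential v J) UNIV"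
    by (simp add: differential_minus differential_differential g)
  also have "\<dots> = laurent f * (\<Sum>i\<in>UNIV. face_sign i UNIV * h i)"
    by (simp add: differential_def[of "\<lambda>J. w J - differential v J"] h(2) sum_distrib_left mult.left_commute)
  finally have "g = (\<Sum>i\<in>UNIV. face_sign i UNIV * h i)"
    using f laurent_eq_iff[of f 0] by simp
  moreover have "face_sign i UNIV * h i \<in> cech_image" for i
    using loc_mult[OF face_sign_in_loc h(1)] loc_subset_cech_image[of i "UNIV - {i}"] by blast
  ultimately show ?thesis by (simp add: cech_image_sum)
qed

text \<open>
  If \<open>g = \<delta> h\<close>, then \<open>w - f h\<close> represents the same cochain of \<open>R/fR\<close> and is a cocycle of the polynomial ring, hence a
  coboundary.
\<close>

lemma cech_image_imp_coboundary:
  fixes f :: "('v::{finite,linorder}, 'k::field) mpoly"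
  assumes card: "card (UNIV :: 'v set) = n + 1"
    and w: "w \<in> laurent_cochains"
    and g: "differential w UNIV = laurent f * g" "g \<in> cech_image"
  shows "cochain_class f n w \<in> coboundaries f n"
proof -
  define h where "h J = (\<Sum>i\<in>UNIV. if J = UNIV - {i} then face_sign i UNIV * dir_part i g else 0)" for J
  have h_eq: "h (UNIV - {i}) = face_sign i UNIV * dir_part i g" for i
  proof -
    have "UNIV - {i} = UNIV - {j} \<longleftrightarrow> j = i" for j by blast
    then show ?thesis by (simp add: h_def)
  qed
  have "h \<in> laurent_cochains"
    unfolding laurent_cochains_def h_def
  proof (intro CollectI allI loc_sum)
    fix J and i :: 'v
    show "(if J = UNIV - {i} then face_sign i UNIV * dir_part i g else 0) \<in> loc J"
      using dir_part_in_loc[of g UNIV i] by (auto intro: loc_mult)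
  qed
  then have w': "(\<lambda>J. w J - laurent f * h J) \<in> laurent_cochains"
    using w by (simp add: laurent_cochains_def loc_diff loc_mult)
  have "differential h UNIV = (\<Sum>i\<in>UNIV. dir_part i g)"
    unfolding differential_def h_eq by (simp flip: mult.assoc)
  also have "\<dots> = g" using g(2) by (rule sum_dir_part)
  finally have "differential (\<lambda>J. w J - laurent f * h J) UNIV = 0"
    by (simp add: differential_minus differential_scale g(1))
  then obtain v where v: "v \<in> laurent_cochains"
    "\<And>k. w (UNIV - {k}) - laurent f * h (UNIV - {k}) = differential v (UNIV - {k})"
    using cech_exact[OF w'] by blast
  have "w J - differential v J \<in> multiples f J" if J: "card J = n" for J
  proof -
    have "card (UNIV - J) = 1" using J card by (simp add: card_Diff_subset)
    then obtain k where "UNIV - J = {k}" by (rule card_1_singletonE)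
    then have k: "J = UNIV - {k}" by blast
    have "w J - differential v J = laurent f * h J"
      using v(2)[of k] unfolding k by (simp add: algebra_simps)
    then show ?thesis
      unfolding multiples_def using laurent_cochainsD[OF \<open>h \<in> laurent_cochains\<close>, of J] by blast
  qed
  then have "cochain_class f n w = cochain_class f n (differential v)"
    unfolding cochain_class_eq_iff[OF w differential_in_cochains[OF v(1)]] by blast
  then show ?thesis unfolding cech_coboundaries_eq using v(1) by blast
qed

text \<open>
  For \<open>f = 0\<close> every class satisfies \<open>f\<^sup>p\<^sup>-\<^sup>1 g\<^sup>p = 0\<close>, so the injectivity above fails on any monomial of small degree with all
  exponents negative.
\<close>

lemma test_ideal_power_imp_nonzero:
  fixes f :: "('v::{finite,linorder}, 'k::field) mpoly" and n j :: nat
  assumes p: "Factorial_Ring.prime p" "p = CHAR('k)" and card: "card (UNIV :: 'v set) = n + 1"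
    and test: "test_ideal mpoly_ring p f = irrelevant_ideal [^]\<^bsub>ideals_set mpoly_ring\<^esub> j"
  shows "f \<noteq> 0"
proof
  assume "f = 0"
  define a where "a = (\<Sum>v\<in>UNIV. single v (- int n - int j - 1) :: 'v \<Rightarrow>\<^sub>0 int)"
  have a: "lookup a v = - int n - int j - 1" for v
    by (simp add: a_def lookup_sum lookup_single when_def)
  have "(single a 1 :: ('v, 'k) laurent) \<in> cech_image"
  proof (rule frobenius_twist_injective[OF p card test])
    fix b assume "b \<in> keys (single a 1 :: ('v, 'k) laurent)"
    then have "total_degree b = int (n + 1) * (- int n - int j - 1)"
      by (simp add: total_degree_def a card)
    also have "\<dots> \<le> 1 * (- int n - int j - 1)"
      by (intro mult_right_mono_neg) auto
    finally show "total_degree b < - int n - int j" by simp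
  next
    have "p - 1 > 0" using prime_gt_1_nat[OF p(1)] by simp
    then show "laurent (f ^ (p - 1)) * (single a 1 :: ('v, 'k) laurent) ^ p \<in> cech_image"
      using \<open>f = 0\<close> by (simp add: zero_power)
  qed
  then show False by (simp add: cech_image_def a)
qed

text \<open>
  With \<open>\<delta> w = f g\<close> one has \<open>\<delta>(w\<^sup>p) = f\<^sup>p g\<^sup>p = f (f\<^sup>p\<^sup>-\<^sup>1 g\<^sup>p)\<close>, so Frobenius replaces \<open>g\<close> by \<open>f\<^sup>p\<^sup>-\<^sup>1 g\<^sup>p\<close>. The degrees in \<open>g\<close> are
  those in \<open>w\<close> lowered by \<open>d\<close>, as the Laurent polynomials form a domain and \<open>f\<close> is homogeneous.
\<close>

lemma frobenius_kernel_trivial: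
  fixes f :: "('v::{finite,linorder}, 'k::field) mpoly"
  assumes p: "Factorial_Ring.prime p" "p = CHAR('k)" and card: "card (UNIV :: 'v set) = n + 1"
    and f: "f \<in> homogeneous_polys (int d)"
    and test: "test_ideal mpoly_ring p f = irrelevant_ideal [^]\<^bsub>ideals_set mpoly_ring\<^esub> j"
    and w: "w \<in> laurent_cocycles f n"
    and low: "\<And>J a. a \<in> keys (w J) \<Longrightarrow> total_degree a < - int n - int j + int d"
    and zero: "cohomology_class f n (\<lambda>J. w J ^ p) = \<one>\<^bsub>cohomology f n\<^esub>"
  shows "cohomology_class f n w = \<one>\<^bsub>cohomology f n\<^esub>"
proof -
  have f0: "f \<noteq> 0" by (rule test_ideal_power_imp_nonzero[OF p card test])
  have coch: "w \<in> laurent_cochains" using w by (rule laurent_cocyclesD)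
  have "differential w UNIV \<in> multiples f UNIV" using w card by (simp add: laurent_cocycles_def)
  then obtain g where g: "differential w UNIV = laurent f * g" unfolding multiples_def by blast
  have "g \<in> cech_image"
  proof (rule frobenius_twist_injective[OF p card test])
    have "differential (\<lambda>J. w J ^ p) UNIV = laurent f * (laurent (f ^ (p - 1)) * g ^ p)"
    proof -
      have "laurent f ^ p = laurent f * laurent f ^ (p - 1)"
        using prime_gt_0_nat[OF p(1)] by (simp add: power_eq_if)
      then show ?thesis
        by (simp add: differential_frobenius[OF p] g power_mult_distrib laurent_power mult.assoc)
    qed
    then show "laurent (f ^ (p - 1)) * g ^ p \<in> cech_image"
      using zero unfolding cohomology_class_eq_one_iff[OF laurent_cochains_power[OF coch]]
      by (intro coboundary_imp_cech_image[OF card f0 laurent_cochains_power[OF coch]])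
  next
    fix a assume a: "a \<in> keys g"
    define N where "N = - int n - int j + int d"
    have "project (\<lambda>a. N \<le> total_degree a) (differential w UNIV) = 0"
      unfolding differential_def project_sum project_sign
    proof (intro sum.neutral ballI)
      fix i
      have "project (\<lambda>a. N \<le> total_degree a) (w (UNIV - {i})) = 0"
        using low by (intro poly_mapping_eqI) (fastforce simp: lookup_project when_def N_def in_keys_iff)
      then show "face_sign i UNIV * project (\<lambda>a. N \<le> total_degree a) (w (UNIV - {i})) = 0" by simp
    qed
    then have "laurent f * project (\<lambda>a. N \<le> total_degree a + int d) g = 0"
      unfolding g using project_homogeneous_mult[OF f, of "\<lambda>x. N \<le> x" g] by simp
    then have "project (\<lambda>a. N \<le> total_degree a + int d) g = 0"
      using f0 laurent_eq_iff[of f 0] by simp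
    then have "lookup (project (\<lambda>a. N \<le> total_degree a + int d) g) a = 0" by simp
    then have "\<not> N \<le> total_degree a + int d"
      using a by (auto simp: lookup_project in_keys_iff)
    then show "total_degree a < - int n - int j" by (simp add: N_def)
  qed
  then have "cochain_class f n w \<in> coboundaries f n"
    by (rule cech_image_imp_coboundary[OF card coch g])
  then show ?thesis unfolding cohomology_class_eq_one_iff[OF coch] .
qed

abbreviation frob_map :: "('v::{finite,linorder}, 'k::field) mpoly \<Rightarrow> nat \<Rightarrow> nat \<Rightarrow> ('v set \<Rightarrow> (('v, 'k) mpoly set \<times> ('v, 'k) mpoly set) set) set \<Rightarrow> ('v set \<Rightarrow> (('v, 'k) mpoly set \<times> ('v, 'k) mpoly set) set) set"
  where "frob_map f p q \<equiv> frobenius_action (hypersurface_ring f) (hvar f) p q"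

lemma frob_map_group_hom:
  fixes f :: "('v::{finite,linorder}, 'k::field) mpoly"
  assumes p: "Factorial_Ring.prime p" "p = CHAR('k)"
  shows "group_hom (cohomology f q) (cohomology f q) (frob_map f p q)"
proof (intro group_hom.intro group_hom_axioms.intro cohomology_group homI)
  fix U assume "U \<in> carrier (cohomology f q)"
  then obtain w where w: "w \<in> laurent_cocycles f q" "U = cohomology_class f q w"
    unfolding carrier_cohomology by blast
  show "frob_map f p q U \<in> carrier (cohomology f q)"
    using laurent_cocycles_power[OF p w(1)] w
    by (simp add: carrier_cohomology frobenius_action_class[OF p] laurent_cocyclesD)
  fix V assume "V \<in> carrier (cohomology f q)"
  then obtain w' where w': "w' \<in> laurent_cocycles f q" "V = cohomology_class f q w'"
    unfolding carrier_cohomology by blast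
  have dream: "(w J + w' J) ^ p = w J ^ p + w' J ^ p" for J
    using p by (intro freshmans_dream) simp_all
  show "frob_map f p q (U \<otimes>\<^bsub>cohomology f q\<^esub> V) = frob_map f p q U \<otimes>\<^bsub>cohomology f q\<^esub> frob_map f p q V"
    using w w'
    by (simp add: cohomology_class_mult frobenius_action_class[OF p] laurent_cocyclesD
        laurent_cocycles_power[OF p] laurent_cochains_add dream)
qed

lemma frob_map_piece:
  fixes f :: "('v::{finite,linorder}, 'k::field) mpoly"
  assumes p: "Factorial_Ring.prime p" "p = CHAR('k)" and f: "f \<in> homogeneous_polys d"
    and U: "U \<in> local_cohomology_piece (hypersurface_ring f) (residue_grading f) (hvar f) q i"
  shows "frob_map f p q U \<in> local_cohomology_piece (hypersurface_ring f) (residue_grading f) (hvar f) q (int p * i)"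
proof -
  obtain w where w: "w \<in> laurent_cocycles f q" "\<And>J. w J \<in> loc_piece J i" "U = cohomology_class f q w"
    using U unfolding local_cohomology_piece_eq[OF f] by blast
  have "(\<lambda>J. w J ^ p) \<in> {w \<in> laurent_cocycles f q. \<forall>J. w J \<in> loc_piece J (int p * i)}"
    using laurent_cocycles_power[OF p w(1)] loc_piece_power[OF w(2)] by simp
  then show ?thesis
    unfolding local_cohomology_piece_eq[OF f] w(3) frobenius_action_class[OF p laurent_cocyclesD[OF w(1)]]
    by (rule imageI)
qed

text \<open>
  Only the bound on the degrees is recorded, not a decomposition into homogeneous cocycles; the bound is stable under the
  group operations.
\<close>

lemma low_degree_representative:
  fixes f :: "('v::{finite,linorder}, 'k::field) mpoly"
  assumes f: "f \<in> homogeneous_polys d"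
    and U: "U \<in> generate (cohomology f q) (\<Union>i\<in>{..<N}. local_cohomology_piece (hypersurface_ring f) (residue_grading f) (hvar f) q i)"
  obtains w where "w \<in> laurent_cocycles f q" "\<And>J a. a \<in> keys (w J) \<Longrightarrow> total_degree a < N"
    "U = cohomology_class f q w"
proof -
  define W where "W = {w \<in> laurent_cocycles f q. \<forall>J. \<forall>a\<in>keys (w J). total_degree a < N}"
  have uminus: "(\<lambda>J. - w J) \<in> W" if "w \<in> W" for w
    using that laurent_cocycles_uminus[of w f q] by (simp add: W_def)
  have piece: "w \<in> W" if "w \<in> laurent_cocycles f q" "\<forall>J. w J \<in> loc_piece J i" "i < N" for w i
    using that unfolding W_def loc_piece_def by auto
  have "U \<in> cohomology_class f q ` W"
    using U
  proof (induction U rule: generate.induct)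
    case one
    have "(\<lambda>J. 0) \<in> W" using laurent_cocycles_zero by (simp add: W_def)
    then show ?case using cohomology_class_zero by (metis image_eqI)
  next
    case (incl U)
    then show ?case unfolding local_cohomology_piece_eq[OF f] using piece by blast
  next
    case (inv U)
    then obtain w where w: "w \<in> W" "U = cohomology_class f q w"
      unfolding local_cohomology_piece_eq[OF f] using piece by blast
    then have "inv\<^bsub>cohomology f q\<^esub> U = cohomology_class f q (\<lambda>J. - w J)"
      by (simp add: W_def cohomology_class_inv)
    then show ?case using uminus[OF w(1)] by blast
  next
    case (eng U V)
    then obtain w w' where w: "w \<in> W" "U = cohomology_class f q w" and w': "w' \<in> W" "V = cohomology_class f q w'"
      by blast
    have "U \<otimes>\<^bsub>cohomology f q\<^esub> V = cohomology_class f q (\<lambda>J. w J + w' J)"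
      using w w' by (simp add: W_def cohomology_class_mult)
    moreover have "(\<lambda>J. w J + w' J) \<in> W"
    proof -
      have "total_degree a < N" if "a \<in> keys (w J + w' J)" for J a
        using subsetD[OF Poly_Mapping.keys_add that] w(1) w'(1) unfolding W_def by (elim UnE) simp_all
      then show ?thesis using w(1) w'(1) laurent_cocycles_add[of w f q w'] unfolding W_def by simp
    qed
    ultimately show ?case by blast
  qed
  then show ?thesis using that unfolding W_def by blast
qed

theorem mainTheorem1:
  fixes f :: "('v::{finite,linorder}, 'k::field) mpoly" and n d j p :: nat
  assumes "card (UNIV :: 'v set) = n + 1"
    and "CHAR('k) = p" and "p > 0"
    and "ring.finite_dimension (ring_of_type_algebra :: 'k ring) (range (\<lambda>a. a ^ p)) UNIV"
    and "f \<in> homogeneous_polys (int d)"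
    and "j \<ge> 1"
    and "test_ideal mpoly_ring p f = irrelevant_ideal [^]\<^bsub>ideals_set mpoly_ring\<^esub> j"
  defines "N \<equiv> - int n - int j + int d"
    and "H \<equiv> local_cohomology_below (hypersurface_ring f) (residue_grading f) (residue f \<circ> mpoly_var) n"
    and "F \<equiv> frobenius_action (hypersurface_ring f) (residue f \<circ> mpoly_var) p n"
  shows "F \<in> hom (H N) (H (int p * N)) \<and> inj_on F (carrier (H N))"
proof -
  have p: "Factorial_Ring.prime p" "p = CHAR('k)"
    using prime_CHAR_semidom[where ?'a = 'k] assms(2,3) by simp_all
  have F: "F = frob_map f p n" unfolding F_def hvar_def ..
  define pieces where "pieces M = (\<Union>i\<in>{..<M}. local_cohomology_piece (hypersurface_ring f) (residue_grading f) (hvar f) n i)" for M :: int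
  have H: "H M = (cohomology f n)\<lparr>carrier := generate (cohomology f n) (pieces M)\<rparr>" for M
    unfolding H_def local_cohomology_below_def pieces_def hvar_def ..
  interpret F: group_hom "cohomology f n" "cohomology f n" F
    unfolding F by (rule frob_map_group_hom[OF p])
  have carr: "pieces M \<subseteq> carrier (cohomology f n)" for M
    unfolding pieces_def local_cohomology_piece_eq[OF assms(5)] carrier_cohomology by blast
  have sub: "subgroup (generate (cohomology f n) (pieces M)) (cohomology f n)" for M
    by (rule F.G.generate_is_subgroup[OF carr])
  have "F ` pieces N \<subseteq> pieces (int p * N)"
  proof
    fix U assume "U \<in> F ` pieces N"
    then obtain i V where i: "i < N" "U = F V"
      "V \<in> local_cohomology_piece (hypersurface_ring f) (residue_grading f) (hvar f) n i"
      unfolding pieces_def by blast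
    then show "U \<in> pieces (int p * N)"
      using frob_map_piece[OF p assms(5) i(3)] assms(3) unfolding pieces_def F by auto
  qed
  then have maps: "F ` generate (cohomology f n) (pieces N) \<subseteq> generate (cohomology f n) (pieces (int p * N))"
    unfolding F.generate_img[OF carr, symmetric] by (rule F.G.mono_generate)
  have hom: "F \<in> hom (H N) (H (int p * N))"
    using maps subgroup.subset[OF sub, of N] unfolding H by (intro homI) (auto simp: subset_iff)
  interpret HN: group_hom "H N" "cohomology f n" F
  proof (intro group_hom.intro group_hom_axioms.intro cohomology_group homI)
    show "group (H N)" unfolding H by (rule F.G.subgroup_imp_group[OF sub])
  qed (use subgroup.subset[OF sub, of N] in \<open>auto simp: H subset_iff\<close>)
  have "U = \<one>\<^bsub>H N\<^esub>" if U: "U \<in> carrier (H N)" "F U = \<one>\<^bsub>cohomology f n\<^esub>" for U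
  proof -
    obtain w where w: "w \<in> laurent_cocycles f n" "\<And>J a. a \<in> keys (w J) \<Longrightarrow> total_degree a < N"
      "U = cohomology_class f n w"
      using low_degree_representative[OF assms(5), of U n N] U(1) unfolding H pieces_def by auto
    have "cohomology_class f n w = \<one>\<^bsub>cohomology f n\<^esub>"
      using frobenius_kernel_trivial[OF p assms(1,5,7) w(1)] w(2) U(2)
      unfolding F w(3) frobenius_action_class[OF p laurent_cocyclesD[OF w(1)]] N_def by blast
    then show ?thesis by (simp add: w(3) H)
  qed
  then have "inj_on F (carrier (H N))"
    by (subst HN.inj_on_one_iff) blast
  with hom show ?thesis ..
qed

end
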